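(* A balanced Lu-Kumar network, with $m_1+m_4=m_2+m_3=1$, is robustly queue-ratio stable if (i) the nominal-load condition is satisfied: $\rho_1=\rho_2<1$ (equivalently, $\alpha_1<1$); (ii) $m_2+m_4<1$.
   Context: Lu-Kumar network: $J=2$ stations, $K=4$ classes. Jobs arrive exogenously only to class $1$, at rate $\alpha_1\ge0$, and follow the deterministic route $1\to2\to3\to4\to$ exit (so $P_{k,k+1}=1$ for $k=1,2,3$, all other $P_{kl}=0$, $\alpha=(\alpha_1,0,0,0)'$). Station 1 serves classes $1,4$; station 2 serves classes $2,3$; $s(k)$ is the station serving class $k$. $m_k>0$ is the mean service time of class $k$, $M=\mathrm{diag}(m_1,\dots,m_4)$, $C$ is the $2\times4$ matrix with $C_{jk}=1$ if $s(k)=j$ and $0$ otherwise, $Q=(I-P')^{-1}$, $\rho=CMQ\alpha$, $e$ is the all-ones vector. The network is balanced if $\rho_1=\rho_2$; time is normalized so that the common value of $m_1+m_4$ and $m_2+m_3$ is $1$. A ratio matrix (encoding a queue-ratio policy) is a nonnegative $K\times J$ matrix $\Delta$ with $\Delta_{kj}=0$ if $s(k)\ne j$, and $CM\Delta=I$. When $CMQ\Delta$ is invertible, $R_\Delta=(CMQ\Delta)^{-1}$ and $\theta_\Delta=R_\Delta(\rho-e)$. Fluid model under $\Delta$. A solution consists of Lipschitz functions on $[0,\infty)$ satisfying: $\bar Z(t)=\bar Z(0)+\alpha t-(I-P')M^{-1}\bar T(t)\ge 0$; $\bar W(t)=CM\bar Z(t)$; $\bar\epsilon(t)=\bar Z(t)-\Delta\bar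 W(t)$; $\bar T(0)=0$ and $\bar T$ is nondecreasing; $\bar Y(t)=et-C\bar T(t)$ is nondecreasing; $\int_0^\infty \bar W_j(s)\,d\bar Y_j(s)=0$ for each $j$; and for each class $k$ and each time $t$ of differentiability, $\bar\epsilon_k^+(t)\bigl(1-\dot{\bar T}{}_k^+(t)\bigr)=0$, where $\bar\epsilon_k^+(t)=\sum_{i\le k:\,s(i)=s(k),\,\bar\epsilon_i(t)>0}\bar\epsilon_i(t)$ and $\dot{\bar T}{}_k^+(t)=\sum_{i\le k:\,s(i)=s(k),\,\bar\epsilon_i(t)>0}\dot{\bar T}_i(t)$. State-space collapse (SSC) under $\Delta$: for every fluid solution there is $t_0\ge0$ (possibly depending on $\bar Z(0)$) with $\bar Z(t)=\Delta\bar W(t)$ for all $t\ge t_0$. Skorohod problem (SP) with data $(R,\theta)$: given $\bar W(0)\ge0$, a pair of continuous functions $(\bar Y,\bar W)$ is a solution if $\bar W(t)=\bar W(0)+\theta t+R\bar Y(t)\ge0$, $\bar Y(0)=0$, $\bar Y$ is nondecreasing, and $\int_0^\infty\bar W_j(t)\,d\bar Y_j(t)=0$ for all $j$. It is stable if for every solution there is $T<\infty$ with $\bar W(t)=0$ for all $t\ge T$. After state-space collapse the fluid workload $\bar W$ solves the SP with data $(R_\Delta,\theta_\Delta)$. Robust queue-ratio stability of the network: for every ratio matrix $\Delta$, the fluid model satisfies SSC, $CMQ\Delta$ is invertible, and the SP with data $(R_\Delta,\theta_\Delta)$ is stable (so that the collapsed fluid workload empties in finite time). *)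

theory Defs
  imports "HOL-Analysis.Analysis"
begin

text \<open>
  Classes are indexed by the type \<open>4\<close> and stations by the type \<open>2\<close>. In these types
  \<open>4 = 0\<close> and \<open>2 = 0\<close>, so the order of the numeral types is not the order of
  the class numbers; the latter is obtained through \<open>class_no\<close>.
\<close>

definition class_no :: "4 \<Rightarrow> nat" where
  "class_no k = (if k = 1 then 1 else if k = 2 then 2 else if k = 3 then 3 else 4)"

definition station :: "4 \<Rightarrow> 2" where
  "station k = (if k = 1 \<or> k = 4 then 1 else 2)"

definition routing :: "real^4^4" where
  "routing = (\<chi> k l. if (k, l) \<in> {(1, 2), (2, 3), (3, 4)} then 1 else 0)"

definition arrivals :: "real \<Rightarrow> real^4" where
  "arrivals \<alpha>1 = (\<chi> k. if k = 1 then \<alpha>1 else 0)"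

definition Cmat :: "real^4^2" where
  "Cmat = (\<chi> j k. if station k = j then 1 else 0)"

definition Mmat :: "real^4 \<Rightarrow> real^4^4" where
  "Mmat m = (\<chi> k l. if k = l then m $ k else 0)"

definition Qmat :: "real^4^4" where
  "Qmat = matrix_inv (mat 1 - transpose routing)"

definition load :: "real \<Rightarrow> real^4 \<Rightarrow> real^2" where
  "load \<alpha>1 m = (Cmat ** Mmat m ** Qmat) *v arrivals \<alpha>1"

definition balanced :: "real \<Rightarrow> real^4 \<Rightarrow> bool" where
  "balanced \<alpha>1 m \<longleftrightarrow> load \<alpha>1 m $ 1 = load \<alpha>1 m $ 2"

definition ratio_matrix :: "real^4 \<Rightarrow> real^2^4 \<Rightarrow> bool" where
  "ratio_matrix m \<Delta> \<longleftrightarrow>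
     (\<forall>k j. 0 \<le> \<Delta> $ k $ j) \<and>
     (\<forall>k j. station k \<noteq> j \<longrightarrow> \<Delta> $ k $ j = 0) \<and>
     Cmat ** Mmat m ** \<Delta> = mat 1"

text \<open>
  The Lebesgue--Stieltjes integral of \<open>g \<ge> 0\<close> over \<open>[0, \<infinity>)\<close> with respect to a continuous
  nondecreasing \<open>F\<close> on \<open>[0, \<infinity>)\<close>. Extending \<open>F\<close> to the left by the constant \<open>F 0\<close>
  puts no mass on \<open>(-\<infinity>, 0]\<close>.
\<close>

definition stieltjes_integral :: "(real \<Rightarrow> real) \<Rightarrow> (real \<Rightarrow> real) \<Rightarrow> ennreal" where
  "stieltjes_integral g F =
     (\<integral>\<^sup>+t\<in>{0..}. ennreal (g t) \<partial>interval_measure (\<lambda>t. F (max 0 t)))"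

definition pos_classes_upto :: "real^4 \<Rightarrow> 4 \<Rightarrow> 4 set" where
  "pos_classes_upto \<epsilon> k =
     {i. class_no i \<le> class_no k \<and> station i = station k \<and> \<epsilon> $ i > 0}"

definition fluid_solution ::
  "real \<Rightarrow> real^4 \<Rightarrow> real^2^4 \<Rightarrow> (real \<Rightarrow> real^4) \<Rightarrow> (real \<Rightarrow> real^2) \<Rightarrow> (real \<Rightarrow> real^4)
     \<Rightarrow> (real \<Rightarrow> real^4) \<Rightarrow> (real \<Rightarrow> real^2) \<Rightarrow> bool" where
  "fluid_solution \<alpha>1 m \<Delta> Z W \<epsilon> T Y \<longleftrightarrow>
     (\<exists>L. L-lipschitz_on {0..} Z) \<and> (\<exists>L. L-lipschitz_on {0..} W) \<and>
     (\<exists>L. L-lipschitz_on {0..} \<epsilon>) \<and> (\<exists>L. L-lipschitz_on {0..} T) \<and>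
     (\<exists>L. L-lipschitz_on {0..} Y) \<and>
     (\<forall>t\<ge>0. Z t = Z 0 + t *\<^sub>R arrivals \<alpha>1
                 - ((mat 1 - transpose routing) ** matrix_inv (Mmat m)) *v T t) \<and>
     (\<forall>t\<ge>0. \<forall>k. 0 \<le> Z t $ k) \<and>
     (\<forall>t\<ge>0. W t = (Cmat ** Mmat m) *v Z t) \<and>
     (\<forall>t\<ge>0. \<epsilon> t = Z t - \<Delta> *v W t) \<and>
     T 0 = 0 \<and> (\<forall>k. mono_on {0..} (\<lambda>t. T t $ k)) \<and>
     (\<forall>t\<ge>0. Y t = t *\<^sub>R (\<chi> j. 1) - Cmat *v T t) \<and> (\<forall>j. mono_on {0..} (\<lambda>t. Y t $ j)) \<and>
     (\<forall>j. stieltjes_integral (\<lambda>t. W t $ j) (\<lambda>t. Y t $ j) = 0) \<and>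
     (\<forall>k. \<forall>t>0. T differentiable (at t) \<longrightarrow>
        (\<Sum>i\<in>pos_classes_upto (\<epsilon> t) k. \<epsilon> t $ i) *
        (1 - (\<Sum>i\<in>pos_classes_upto (\<epsilon> t) k. vector_derivative T (at t) $ i)) = 0)"

definition SSC :: "real \<Rightarrow> real^4 \<Rightarrow> real^2^4 \<Rightarrow> bool" where
  "SSC \<alpha>1 m \<Delta> \<longleftrightarrow>
     (\<forall>Z W \<epsilon> T Y. fluid_solution \<alpha>1 m \<Delta> Z W \<epsilon> T Y \<longrightarrow>
        (\<exists>t0\<ge>0. \<forall>t\<ge>t0. Z t = \<Delta> *v W t))"

definition SP_solution ::
  "real^2^2 \<Rightarrow> real^2 \<Rightarrow> (real \<Rightarrow> real^2) \<Rightarrow> (real \<Rightarrow> real^2) \<Rightarrow> bool" where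
  "SP_solution R \<theta> Y W \<longleftrightarrow>
     continuous_on {0..} Y \<and> continuous_on {0..} W \<and>
     (\<forall>t\<ge>0. W t = W 0 + t *\<^sub>R \<theta> + R *v Y t) \<and>
     (\<forall>t\<ge>0. \<forall>j. 0 \<le> W t $ j) \<and>
     Y 0 = 0 \<and> (\<forall>j. mono_on {0..} (\<lambda>t. Y t $ j)) \<and>
     (\<forall>j. stieltjes_integral (\<lambda>t. W t $ j) (\<lambda>t. Y t $ j) = 0)"

definition SP_stable :: "real^2^2 \<Rightarrow> real^2 \<Rightarrow> bool" where
  "SP_stable R \<theta> \<longleftrightarrow>
     (\<forall>Y W. SP_solution R \<theta> Y W \<longrightarrow> (\<exists>T\<ge>0. \<forall>t\<ge>T. W t = 0))"

definition Rmat :: "real^4 \<Rightarrow> real^2^4 \<Rightarrow> real^2^2" where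
  "Rmat m \<Delta> = matrix_inv (Cmat ** Mmat m ** Qmat ** \<Delta>)"

definition drift :: "real \<Rightarrow> real^4 \<Rightarrow> real^2^4 \<Rightarrow> real^2" where
  "drift \<alpha>1 m \<Delta> = Rmat m \<Delta> *v (load \<alpha>1 m - (\<chi> j. 1))"

definition robustly_queue_ratio_stable :: "real \<Rightarrow> real^4 \<Rightarrow> bool" where
  "robustly_queue_ratio_stable \<alpha>1 m \<longleftrightarrow>
     (\<forall>\<Delta>. ratio_matrix m \<Delta> \<longrightarrow>
        SSC \<alpha>1 m \<Delta> \<and>
        invertible (Cmat ** Mmat m ** Qmat ** \<Delta>) \<and>
        SP_stable (Rmat m \<Delta>) (drift \<alpha>1 m \<Delta>))"

end

theory Submission
  imports Defs
begin

text \<open>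
  State-space collapse: at each station the two components of \<open>\<epsilon>\<close> are opposite multiples of one
  scalar, \<open>x = \<Delta>\<^sub>4\<^sub>1 Z\<^sub>1 - \<Delta>\<^sub>1\<^sub>1 Z\<^sub>4\<close> at station 1 and \<open>y = \<Delta>\<^sub>3\<^sub>2 Z\<^sub>2 - \<Delta>\<^sub>2\<^sub>2 Z\<^sub>3\<close> at station 2. As long as
  the scalar is nonzero, the policy gives the whole station to the class with excess. Since
  \<open>m\<^sub>2 + m\<^sub>4 < 1\<close> means \<open>m\<^sub>2 < m\<^sub>1\<close> and \<open>m\<^sub>4 < m\<^sub>3\<close>, that class is drained faster than the other station
  can feed it, so \<open>\<bar>x\<bar>\<close> and \<open>\<bar>y\<bar>\<close> decrease at uniform rates until they vanish. The policy only
  speaks about points of differentiability of \<open>T\<close>, so this needs Lebesgue's theorem that a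
  monotone Lipschitz function is differentiable almost everywhere, obtained here from the Vitali
  covering theorem.

  Skorohod problem: with \<open>G = CMQ\<Delta>\<close>, each component of \<open>G W\<close> decreases at rate \<open>1 - \<alpha>\<^sub>1\<close> while the
  corresponding component of \<open>W\<close> is positive, and a weighted maximum of the two components
  is a Lyapunov function.
\<close>

section \<open>Almost everywhere differentiability of monotone Lipschitz functions\<close>

text \<open>A Lipschitz map sends the null set \<open>N\<close> to a null set, so if
  \<open>f a < f b\<close>, some level \<open>y\<close> strictly between the two values is not
  attained on \<open>N\<close>. At the last point with \<open>f \<le> y\<close> the value is exactly
  \<open>y\<close>, so the derivative there exists and is negative, and \<open>f\<close> drops below
  \<open>y\<close> just afterwards, a contradiction.\<close>

lemma lipschitz_deriv_neg_imp_le: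
  fixes f :: "real \<Rightarrow> real"
  assumes "a \<le> b" and lip: "L-lipschitz_on {a..b} f" and N: "negligible N"
    and deriv: "\<And>x. a < x \<Longrightarrow> x < b \<Longrightarrow> x \<notin> N \<Longrightarrow> \<exists>D<0. (f has_real_derivative D) (at x)"
  shows "f b \<le> f a"
proof (rule ccontr)
  assume "\<not> f b \<le> f a"
  then have ab: "f a < f b" by simp
  have cont: "continuous_on {a..b} f" using lip by (rule lipschitz_on_continuous_on)
  have "negligible (f ` (N \<inter> {a..b}))"
  proof (rule negligible_locally_Lipschitz_image)
    show "negligible (N \<inter> {a..b})" using N by (rule negligible_subset) auto
    fix x assume x: "x \<in> N \<inter> {a..b}"
    show "\<exists>T B. open T \<and> x \<in> T \<and> (\<forall>y\<in>N \<inter> {a..b} \<inter> T. norm (f y - f x) \<le> B * norm (y - x))"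
      using lipschitz_onD[OF lip] x
      by (intro exI[of _ UNIV] exI[of _ L]) (auto simp: dist_norm)
  qed simp
  moreover have "\<not> negligible {f a<..<f b}"
    using ab by (intro open_not_negligible) auto
  ultimately obtain y where y: "f a < y" "y < f b" "y \<notin> f ` (N \<inter> {a..b})"
    by (metis greaterThanLessThan_iff negligible_subset subsetI)
  define S where "S = {t \<in> {a..b}. f t \<le> y}"
  have "closed S" unfolding S_def
    using continuous_closed_preimage[OF cont, of "{..y}"] by (simp add: vimage_def Int_def)
  moreover have "a \<in> S" "bdd_above S" using y \<open>a \<le> b\<close> by (auto simp: S_def)
  ultimately have x: "Sup S \<in> S" by (metis closed_contains_Sup empty_iff)
  define x where "x = Sup S"
  have xS: "a \<le> x" "x \<le> b" "f x \<le> y" using x by (auto simp: S_def x_def)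
  have above: "f t > y" if "x < t" "t \<le> b" for t
  proof (rule ccontr)
    assume "\<not> f t > y"
    then have "t \<in> S" using that xS by (auto simp: S_def)
    then have "t \<le> x" unfolding x_def using \<open>bdd_above S\<close> by (rule cSup_upper)
    then show False using that by simp
  qed
  have "x < b" using xS y by (cases "x = b") auto
  obtain t where t: "x \<le> t" "t \<le> b" "f t = y"
    using IVT'[of f x y b] xS y continuous_on_subset[OF cont, of "{x..b}"] by auto
  then have "t = x" using above[of t] by fastforce
  then have fx: "f x = y" using t by simp
  have "a < x" using xS y fx by (cases "x = a") auto
  have "x \<notin> N" using y(3) fx xS by auto
  then obtain D where "D < 0" "(f has_real_derivative D) (at x)"
    using deriv \<open>a < x\<close> \<open>x < b\<close> by blast
  then obtain d where d: "d > 0" "\<And>h. 0 < h \<Longrightarrow> h < d \<Longrightarrow> f (x + h) < f x"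
    using DERIV_neg_dec_right by blast
  define h where "h = min (d/2) (b - x)"
  have h: "0 < h" "h < d" "x + h \<le> b" using d(1) \<open>x < b\<close> by (auto simp: h_def min_def)
  then have "f (x + h) < f x" using d(2) by blast
  with above[of "x + h"] h fx show False by simp
qed

text \<open>The Vitali covering theorem for balls, rephrased for small intervals that contain the
  point without being centred at it. In the applications \<open>P\<close> bounds the slope of a
  function over the interval.\<close>

lemma Vitali_covering_intervals:
  fixes E :: "real set"
  assumes "open U" "E \<subseteq> U"
    and fine: "\<And>x d. x \<in> E \<Longrightarrow> 0 < d \<Longrightarrow> \<exists>u v. u < x \<and> x < v \<and> v - u < d \<and> P u v"
  obtains C :: "(real \<times> real) set" where "countable C"
    and "\<And>i. i \<in> C \<Longrightarrow> fst i < snd i \<and> P (fst i) (snd i) \<and> {fst i<..<snd i} \<subseteq> U"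
    and "disjoint_family_on (\<lambda>i. {fst i<..<snd i}) C"
    and "negligible (E - (\<Union>i\<in>C. {fst i<..<snd i}))"
proof -
  define K :: "(real \<times> real) set"
    where "K = {i. fst i < snd i \<and> P (fst i) (snd i) \<and> {fst i<..<snd i} \<subseteq> U}"
  define c :: "real \<times> real \<Rightarrow> real" where "c i = (fst i + snd i) / 2" for i
  define r :: "real \<times> real \<Rightarrow> real" where "r i = (snd i - fst i) / 2" for i
  have ball: "ball (c i) (r i) = {fst i<..<snd i}" for i
    unfolding ball_eq_greaterThanLessThan by (simp add: c_def r_def field_simps)
  have "\<exists>i. i \<in> K \<and> x \<in> ball (c i) (r i) \<and> r i < d" if xd: "x \<in> E" "0 < d" for x d
  proof -
    obtain e where e: "e > 0" "ball x e \<subseteq> U" using assms(1,2) xd by (meson openE subsetD)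
    \<comment> \<open>A length below \<open>e\<close> keeps the interval inside the ball around
      \<open>x\<close>, hence inside \<open>U\<close>.\<close>
    obtain u v where uv: "u < x" "x < v" "v - u < min d e" "P u v"
      using fine[of x "min d e"] xd e by auto
    have "{u<..<v} \<subseteq> ball x e" using uv by (auto simp: dist_real_def)
    then have "(u, v) \<in> K" using uv e by (auto simp: K_def)
    moreover have "x \<in> ball (c (u, v)) (r (u, v))" using uv by (simp add: ball)
    moreover have "r (u, v) < d" using uv by (simp add: r_def)
    ultimately show ?thesis by blast
  qed
  then obtain C where C: "countable C" "C \<subseteq> K"
     "pairwise (\<lambda>i j. disjnt (ball (c i) (r i)) (ball (c j) (r j))) C"
     "negligible(E - (\<Union>i \<in> C. ball (c i) (r i)))"
    by (rule Vitali_covering_theorem_balls)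
  show thesis
  proof
    show "disjoint_family_on (\<lambda>i. {fst i<..<snd i}) C"
      using C(3) unfolding ball by (auto simp: disjoint_family_on_def pairwise_def disjnt_def)
    show "fst i < snd i \<and> P (fst i) (snd i) \<and> {fst i<..<snd i} \<subseteq> U" if "i \<in> C" for i
      using that C(2) unfolding K_def by blast
  qed (use C in \<open>auto simp: ball\<close>)
qed

section \<open>Stieltjes measure and oscillating difference quotients\<close>

lemma emeasure_interval_measure_Ioo:
  fixes f :: "real \<Rightarrow> real"
  assumes "mono f" "continuous_on UNIV f" "u \<le> v"
  shows "emeasure (interval_measure f) {u<..<v} = ennreal (f v - f u)"
proof (cases "u = v")
  case False
  have mono: "\<And>x y. x \<le> y \<Longrightarrow> f x \<le> f y" using assms(1) by (simp add: monoD)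
  \<comment> \<open>By continuity the right endpoint has no mass, so the formula for half-open
    intervals carries over.\<close>
  have "emeasure (interval_measure f) {v..v} = 0"
    using emeasure_interval_measure_Icc[of v v f] mono assms(2) by simp
  moreover have "{u<..v} = {u<..<v} \<union> {v..v}" using assms(3) False by auto
  moreover have "emeasure (interval_measure f) ({u<..<v} \<union> {v..v}) =
      emeasure (interval_measure f) {u<..<v} + emeasure (interval_measure f) {v..v}"
    by (rule plus_emeasure[symmetric]) auto
  moreover have "emeasure (interval_measure f) {u<..v} = ennreal (f v - f u)"
    using assms mono
    by (intro emeasure_interval_measure_Ioc)
       (auto simp: continuous_on_eq_continuous_within intro: continuous_within_subset)
  ultimately show ?thesis by simp
qed auto

text \<open>Two nested Vitali coverings are compared through the Stieltjes measure of
  \<open>f\<close>. Disjoint intervals of slope at most \<open>p\<close> inside an open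
  \<open>U\<close> slightly larger than \<open>V\<close> have union \<open>A\<close> of mass at most
  \<open>p\<close> times the measure of \<open>U\<close>. Disjoint intervals of slope at least
  \<open>q\<close> inside \<open>A\<close> have union \<open>B\<close> of mass at least
  \<open>q\<close> times the measure of \<open>B\<close>. For \<open>p < q\<close> the cover thus
  shrinks by the factor \<open>p / q\<close>, up to \<open>e\<close>.\<close>

lemma lmeasure_contraction:
  fixes f :: "real \<Rightarrow> real"
  assumes "mono f" "continuous_on UNIV f" "0 < p" "0 < q"
    and low: "\<And>x d. x \<in> E \<Longrightarrow> 0 < d \<Longrightarrow>
      \<exists>u v. u < x \<and> x < v \<and> v - u < d \<and> f v - f u \<le> p * (v - u)"
    and upp: "\<And>x d. x \<in> E \<Longrightarrow> 0 < d \<Longrightarrow>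
      \<exists>u v. u < x \<and> x < v \<and> v - u < d \<and> q * (v - u) \<le> f v - f u"
    and V: "V \<in> lmeasurable" "E \<subseteq> V" and "0 < e"
  obtains V' where "V' \<in> lmeasurable" "E \<subseteq> V'"
    "q * measure lebesgue V' \<le> p * (measure lebesgue V + e)"
proof -
  let ?\<mu> = "interval_measure f"
  let ?I = "\<lambda>i::real\<times>real. {fst i<..<snd i}"
  obtain U where U: "open U" "V \<subseteq> U" "U \<in> lmeasurable" "measure lebesgue U < measure lebesgue V + e"
  proof -
    obtain U where U: "open U" "V \<subseteq> U" "U - V \<in> lmeasurable" "emeasure lebesgue (U - V) < ennreal e"
      using sets_lebesgue_outer_open[of V e] V(1) \<open>0 < e\<close> by (auto simp: fmeasurableD)
    have "U = V \<union> (U - V)" using U(2) by auto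
    then have "U \<in> lmeasurable" using V(1) U(3) by (metis fmeasurable.Un)
    moreover have "measure lebesgue (U - V) < e"
      using U(3,4) \<open>0 < e\<close> by (simp add: emeasure_eq_measure2 ennreal_less_iff)
    then have "measure lebesgue U < measure lebesgue V + e"
      using measurable_measure_Diff[OF \<open>U \<in> lmeasurable\<close> fmeasurableD[OF V(1)] U(2)] by simp
    ultimately show thesis using U by (intro that)
  qed
  obtain C where C: "countable C"
    "\<And>i. i \<in> C \<Longrightarrow> fst i < snd i \<and> f (snd i) - f (fst i) \<le> p * (snd i - fst i) \<and> ?I i \<subseteq> U"
    "disjoint_family_on ?I C" "negligible (E - (\<Union>i\<in>C. ?I i))"
    by (rule Vitali_covering_intervals[of U E "\<lambda>u v. f v - f u \<le> p * (v - u)", OF U(1) _ low])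
      (use U(2) V(2) in blast)+
  define A where "A = (\<Union>i\<in>C. ?I i)"
  have "open A" by (auto simp: A_def)
  obtain D where D: "countable D"
    "\<And>i. i \<in> D \<Longrightarrow> fst i < snd i \<and> q * (snd i - fst i) \<le> f (snd i) - f (fst i) \<and> ?I i \<subseteq> A"
    "disjoint_family_on ?I D" "negligible (E \<inter> A - (\<Union>i\<in>D. ?I i))"
    by (rule Vitali_covering_intervals[of A "E \<inter> A" "\<lambda>u v. q * (v - u) \<le> f v - f u", OF \<open>open A\<close> _ upp]) blast+
  define B where "B = (\<Union>i\<in>D. ?I i)"
  have "open B" by (auto simp: B_def)
  have BA: "B \<subseteq> A" and AU: "A \<subseteq> U" using C(2) D(2) unfolding A_def B_def by blast+
  have "emeasure ?\<mu> A = (\<integral>\<^sup>+i. emeasure ?\<mu> (?I i) \<partial>count_space C)"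
    unfolding A_def by (rule emeasure_UN_countable) (use C in auto)
  also have "\<dots> \<le> (\<integral>\<^sup>+i. ennreal p * emeasure lborel (?I i) \<partial>count_space C)"
  proof (rule nn_integral_mono)
    fix i assume "i \<in> space (count_space C)"
    then have i: "fst i < snd i" "f (snd i) - f (fst i) \<le> p * (snd i - fst i)" using C(2) by auto
    then show "emeasure ?\<mu> (?I i) \<le> ennreal p * emeasure lborel (?I i)"
      using assms(1-3) by (simp add: emeasure_interval_measure_Ioo ennreal_mult'[symmetric] ennreal_leI)
  qed
  also have "\<dots> = ennreal p * (\<integral>\<^sup>+i. emeasure lborel (?I i) \<partial>count_space C)"
    by (rule nn_integral_cmult) simp
  also have "(\<integral>\<^sup>+i. emeasure lborel (?I i) \<partial>count_space C) = emeasure lborel A"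
    unfolding A_def by (rule emeasure_UN_countable[symmetric]) (use C in auto)
  also have "emeasure lborel A \<le> emeasure lborel U"
    using AU U(1) by (intro emeasure_mono) auto
  finally have muA: "emeasure ?\<mu> A \<le> ennreal p * emeasure lborel U"
    by (simp add: mult_left_mono)
  have "ennreal q * emeasure lborel B = ennreal q * (\<integral>\<^sup>+i. emeasure lborel (?I i) \<partial>count_space D)"
    unfolding B_def by (subst emeasure_UN_countable) (use D in auto)
  also have "\<dots> = (\<integral>\<^sup>+i. ennreal q * emeasure lborel (?I i) \<partial>count_space D)"
    by (rule nn_integral_cmult[symmetric]) simp
  also have "\<dots> \<le> (\<integral>\<^sup>+i. emeasure ?\<mu> (?I i) \<partial>count_space D)"
  proof (rule nn_integral_mono)
    fix i assume "i \<in> space (count_space D)"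
    then have i: "fst i < snd i" "q * (snd i - fst i) \<le> f (snd i) - f (fst i)" using D(2) by auto
    then show "ennreal q * emeasure lborel (?I i) \<le> emeasure ?\<mu> (?I i)"
      using assms(1-4) by (simp add: emeasure_interval_measure_Ioo ennreal_mult'[symmetric] ennreal_leI)
  qed
  also have "\<dots> = emeasure ?\<mu> B"
    unfolding B_def by (rule emeasure_UN_countable[symmetric]) (use D in auto)
  also have "\<dots> \<le> emeasure ?\<mu> A" using BA \<open>open A\<close> by (intro emeasure_mono) auto
  also note muA
  finally have le: "ennreal q * emeasure lborel B \<le> ennreal p * emeasure lborel U" .
  have BU: "B \<in> lmeasurable"
    using U(3) BA AU \<open>open B\<close> by (intro fmeasurableI2[OF U(3)]) auto
  \<comment> \<open>The coverings miss only a null part of \<open>E\<close>; adding it to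
    \<open>B\<close> gives a true cover of the same measure.\<close>
  have neg: "negligible (E - B)"
  proof (rule negligible_subset)
    show "negligible ((E - A) \<union> (E \<inter> A - B))"
      using C(4) D(4) unfolding A_def[symmetric] B_def[symmetric] by (rule negligible_Un)
  qed auto
  have meq: "emeasure lborel X = ennreal (measure lebesgue X)" if "X \<in> lmeasurable" "open X" for X :: "real set"
    using that emeasure_eq_measure2[of X lebesgue] by simp
  have "q * measure lebesgue B \<le> p * measure lebesgue U"
    using le assms(3,4) BU U(1,3) \<open>open B\<close>
    by (simp add: meq ennreal_mult'[symmetric])
  moreover have "measure lebesgue (B \<union> (E - B)) = measure lebesgue B"
    using neg BU by (intro measure_Un_null_set) (auto simp: negligible_iff_null_sets fmeasurableD)
  moreover have "B \<union> (E - B) \<in> lmeasurable" by (intro fmeasurable.Un BU negligible_imp_measurable neg)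
  moreover have "p * measure lebesgue U \<le> p * (measure lebesgue V + e)" using U(4) \<open>0 < p\<close> by simp
  ultimately show thesis by (intro that[of "B \<union> (E - B)"]) auto
qed

text \<open>Applying the contraction to nearly optimal covers shows that the outer measure
  \<open>s\<close> of a bounded piece of \<open>E\<close> satisfies
  \<open>q * s \<le> p * s\<close>, which forces \<open>s = 0\<close>.\<close>

lemma negligible_slopes_oscillate:
  fixes f :: "real \<Rightarrow> real"
  assumes "mono f" "continuous_on UNIV f" "0 < p" "p < q"
    and low: "\<And>x d. x \<in> E \<Longrightarrow> 0 < d \<Longrightarrow>
      \<exists>u v. u < x \<and> x < v \<and> v - u < d \<and> f v - f u \<le> p * (v - u)"
    and upp: "\<And>x d. x \<in> E \<Longrightarrow> 0 < d \<Longrightarrow>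
      \<exists>u v. u < x \<and> x < v \<and> v - u < d \<and> q * (v - u) \<le> f v - f u"
  shows "negligible E"
proof -
  have "negligible (E \<inter> cbox a b)" for a b
  proof -
    \<comment> \<open>\<open>Inf S\<close> is the outer measure; cutting with a box makes it
      finite.\<close>
    define S where "S = {measure lebesgue V |V. V \<in> lmeasurable \<and> E \<inter> cbox a b \<subseteq> V}"
    have ne: "S \<noteq> {}" and bdd: "bdd_below S"
      by (auto simp: S_def intro!: exI[of _ "cbox a b"] bdd_belowI[of _ 0])
    have "Inf S \<ge> 0" using ne by (intro cInf_greatest) (auto simp: S_def)
    \<comment> \<open>One \<open>e\<close> is lost in choosing \<open>V\<close> near the infimum,
      the other in the contraction.\<close>
    have step: "q * Inf S \<le> p * (Inf S + 2 * e)" if "0 < e" for e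
    proof -
      obtain V where V: "V \<in> lmeasurable" "E \<inter> cbox a b \<subseteq> V" "measure lebesgue V < Inf S + e"
        using cInf_lessD[OF ne, of "Inf S + e"] \<open>0 < e\<close> by (auto simp: S_def)
      obtain V' where V': "V' \<in> lmeasurable" "E \<inter> cbox a b \<subseteq> V'"
        "q * measure lebesgue V' \<le> p * (measure lebesgue V + e)"
      proof (rule lmeasure_contraction[of f p q "E \<inter> cbox a b" V e])
      qed (use assms V(1,2) \<open>0 < e\<close> in auto)
      have "Inf S \<le> measure lebesgue V'" using V' bdd by (intro cInf_lower) (auto simp: S_def)
      then have "q * Inf S \<le> q * measure lebesgue V'" using assms(3,4) by simp
      also note V'(3)
      also have "p * (measure lebesgue V + e) \<le> p * (Inf S + 2 * e)" using V(3) assms(3) by simp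
      finally show ?thesis .
    qed
    have "q * Inf S \<le> p * Inf S"
    proof (rule field_le_epsilon)
      fix d :: real assume "d > 0"
      moreover have "p * (Inf S + 2 * (d / (2 * p))) = p * Inf S + d"
        using assms(3) by (simp add: field_simps)
      ultimately show "q * Inf S \<le> p * Inf S + d"
        using step[of "d / (2 * p)"] assms(3) by simp
    qed
    then have "Inf S \<le> 0"
      using assms(4) mult_le_cancel_right[of q "Inf S" p] by auto
    show ?thesis
      unfolding negligible_outer_le
    proof (intro allI impI)
      fix e :: real assume "e > 0"
      then have "\<exists>x\<in>S. x < e" using cInf_lessD[OF ne, of e] \<open>Inf S \<le> 0\<close> by force
      then show "\<exists>T. E \<inter> cbox a b \<subseteq> T \<and> T \<in> lmeasurable \<and> measure lebesgue T \<le> e"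
        unfolding S_def using less_imp_le by blast
    qed
  qed
  then show ?thesis by (subst negligible_on_intervals) blast
qed

section \<open>From straddling slopes to derivatives\<close>

text \<open>The coverings only see intervals with \<open>x\<close> in their interior. Letting one
  endpoint tend to \<open>x\<close> turns, by continuity, such an estimate into one for the ordinary
  difference quotient.\<close>

lemma has_real_derivative_straddle:
  fixes f :: "real \<Rightarrow> real"
  assumes cont: "continuous_on UNIV f"
    and str: "\<And>e. 0 < e \<Longrightarrow> \<exists>d>0. \<forall>u v. u < x \<and> x < v \<and> v - u < d \<longrightarrow>
               \<bar>f v - f u - D * (v - u)\<bar> \<le> e * (v - u)"
  shows "(f has_real_derivative D) (at x)"
proof -
  have lim: "(f \<longlongrightarrow> f x) (at x within S)" for S
    by (meson UNIV_I cont continuous_on_def subset_UNIV tendsto_within_subset)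
  have "\<exists>s>0. \<forall>y. y \<noteq> x \<and> norm (y - x) < s \<longrightarrow> norm ((f y - f x) / (y - x) - D) < r" if r: "0 < r" for r
  proof -
    obtain d where d: "d > 0" and
      dd: "\<And>u v. u < x \<Longrightarrow> x < v \<Longrightarrow> v - u < d \<Longrightarrow> \<bar>f v - f u - D * (v - u)\<bar> \<le> (r/2) * (v - u)"
      using str[of "r/2"] r by auto
    \<comment> \<open>With \<open>y\<close> and the moving endpoint both within \<open>d/2\<close>
      of \<open>x\<close>, on opposite sides, the interval is shorter than \<open>d\<close>.\<close>
    have bound: "\<bar>f y - f x - D * (y - x)\<bar> \<le> (r/2) * \<bar>y - x\<bar>" if y: "y \<noteq> x" "\<bar>y - x\<bar> < d/2" for y
    proof (cases "x < y")
      case True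
      have "\<bar>f y - f x - D * (y - x)\<bar> \<le> (r/2) * (y - x)"
      proof (rule tendsto_le)
        show "((\<lambda>u. (r/2) * (y - u)) \<longlongrightarrow> (r/2) * (y - x)) (at_left x)"
          by (intro tendsto_intros)
        show "((\<lambda>u. \<bar>f y - f u - D * (y - u)\<bar>) \<longlongrightarrow> \<bar>f y - f x - D * (y - x)\<bar>) (at_left x)"
          by (intro tendsto_intros lim)
        show "\<forall>\<^sub>F u in at_left x. \<bar>f y - f u - D * (y - u)\<bar> \<le> (r/2) * (y - u)"
          unfolding eventually_at_left_field
        proof (intro exI[of _ "x - d/2"] conjI allI impI)
          fix u assume "x - d/2 < u" "u < x"
          then show "\<bar>f y - f u - D * (y - u)\<bar> \<le> (r/2) * (y - u)" using True y by (intro dd) auto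
        qed (use d in auto)
      qed simp
      then show ?thesis using True by simp
    next
      case False
      then have yx: "y < x" using y by simp
      have "\<bar>f x - f y - D * (x - y)\<bar> \<le> (r/2) * (x - y)"
      proof (rule tendsto_le)
        show "((\<lambda>u. (r/2) * (u - y)) \<longlongrightarrow> (r/2) * (x - y)) (at_right x)"
          by (intro tendsto_intros)
        show "((\<lambda>u. \<bar>f u - f y - D * (u - y)\<bar>) \<longlongrightarrow> \<bar>f x - f y - D * (x - y)\<bar>) (at_right x)"
          by (intro tendsto_intros lim)
        show "\<forall>\<^sub>F u in at_right x. \<bar>f u - f y - D * (u - y)\<bar> \<le> (r/2) * (u - y)"
          unfolding eventually_at_right_field
        proof (intro exI[of _ "x + d/2"] conjI allI impI)
          fix u assume "x < u" "u < x + d/2"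
          then show "\<bar>f u - f y - D * (u - y)\<bar> \<le> (r/2) * (u - y)" using yx y by (intro dd) auto
        qed (use d in auto)
      qed simp
      also have "\<bar>f x - f y - D * (x - y)\<bar> = \<bar>f y - f x - D * (y - x)\<bar>"
        by (subst abs_minus_cancel[symmetric]) (simp add: algebra_simps)
      also have "x - y = \<bar>y - x\<bar>" using yx by simp
      finally show ?thesis .
    qed
    show ?thesis
    proof (intro exI conjI allI impI)
      show "d/2 > 0" using d by simp
      fix y assume y: "y \<noteq> x \<and> norm (y - x) < d/2"
      have "(f y - f x) / (y - x) - D = (f y - f x - D * (y - x)) / (y - x)"
        using y by (simp add: field_simps)
      then have "norm ((f y - f x) / (y - x) - D) = \<bar>f y - f x - D * (y - x)\<bar> / \<bar>y - x\<bar>"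
        by (simp add: abs_divide)
      also have "\<dots> \<le> r/2" using bound[of y] y by (simp add: pos_divide_le_eq)
      also have "\<dots> < r" using \<open>0 < r\<close> by simp
      finally show "norm ((f y - f x) / (y - x) - D) < r" .
    qed
  qed
  then show ?thesis
    unfolding has_field_derivative_iff by (intro LIM_I) blast
qed

text \<open>If the lower and upper limits of straddling slopes differ at \<open>x\<close>, two
  rationals \<open>0 < p < q\<close> separate them, so \<open>x\<close> lies in one of countably
  many null sets. Elsewhere the common limit is the derivative, finite by the Lipschitz
  bound.\<close>

lemma mono_lipschitz_ae_differentiable:
  fixes f :: "real \<Rightarrow> real"
  assumes mono: "mono f" and lip: "L-lipschitz_on UNIV f"
  shows "negligible {x. \<not> f differentiable (at x)}"
proof -
  have cont: "continuous_on UNIV f" using lip by (rule lipschitz_on_continuous_on)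
  define low where "low p x \<longleftrightarrow> (\<forall>d>0. \<exists>u v. u < x \<and> x < v \<and> v - u < d \<and> f v - f u \<le> p * (v - u))" for p x
  define upp where "upp q x \<longleftrightarrow> (\<forall>d>0. \<exists>u v. u < x \<and> x < v \<and> v - u < d \<and> q * (v - u) \<le> f v - f u)" for q x
  define Q where "Q = {i \<in> \<rat> \<times> \<rat>. 0 < fst i \<and> fst i < (snd i :: real)}"
  have "countable Q" unfolding Q_def
    by (rule countable_subset[of _ "\<rat> \<times> \<rat>"]) (auto simp: countable_rat)
  moreover have "negligible {x. low (fst i) x \<and> upp (snd i) x}" if "i \<in> Q" for i
    by (rule negligible_slopes_oscillate[OF mono cont, of "fst i" "snd i"])
       (use that in \<open>auto simp: Q_def low_def upp_def\<close>)
  ultimately have neg: "negligible (\<Union>i\<in>Q. {x. low (fst i) x \<and> upp (snd i) x})"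
    by (intro negligible_countable_Union) auto
  have "f differentiable (at x)" if x: "x \<notin> (\<Union>i\<in>Q. {x. low (fst i) x \<and> upp (snd i) x})" for x
  proof -
    \<comment> \<open>\<open>S\<close> holds the numbers strictly below all slopes over sufficiently
      short intervals straddling \<open>x\<close>; its supremum \<open>D\<close> is the lower limit
      of these slopes.\<close>
    define S where "S = {p. \<not> low p x}"
    have fmono: "f u \<le> f v" if "u \<le> v" for u v using mono that by (simp add: monoD)
    have neg_S: "p \<in> S" if "p < 0" for p
    proof -
      have "\<not> (f v - f u \<le> p * (v - u))" if "u < v" for u v
        using fmono[of u v] mult_neg_pos[OF \<open>p < 0\<close>, of "v - u"] that by linarith
      then show ?thesis unfolding S_def low_def
        by (auto intro!: exI[of _ 1] dest: less_trans)
    qed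
    have S_le: "p \<le> L" if pS: "p \<in> S" for p
    proof -
      obtain d where d: "d > 0" "\<And>u v. u < x \<Longrightarrow> x < v \<Longrightarrow> v - u < d \<Longrightarrow> \<not> f v - f u \<le> p * (v - u)"
        using pS unfolding S_def low_def by auto
      have "p * (d/2) < f (x + d/4) - f (x - d/4)" using d(2)[of "x - d/4" "x + d/4"] d(1) by simp
      also have "\<dots> \<le> dist (f (x + d/4)) (f (x - d/4))" by (simp add: dist_real_def)
      also have "\<dots> \<le> L * dist (x + d/4) (x - d/4)" by (rule lipschitz_onD[OF lip UNIV_I UNIV_I])
      also have "dist (x + d/4) (x - d/4) = d/2" using d(1) by (simp add: dist_real_def)
      finally show ?thesis using d(1) by simp
    qed
    have bdd: "bdd_above S" using S_le by (intro bdd_aboveI)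
    have ne: "S \<noteq> {}" using neg_S[of "-1"] by auto
    define D where "D = Sup S"
    have D0: "0 \<le> D"
    proof (rule field_le_epsilon)
      fix e :: real assume "0 < e"
      then show "0 \<le> D + e" using cSup_upper[OF neg_S[of "-e"] bdd] by (simp add: D_def)
    qed
    have "(f has_real_derivative D) (at x)"
    proof (rule has_real_derivative_straddle[OF cont])
      fix e :: real assume "0 < e"
      obtain p where "p \<in> S" "D - e < p"
        using less_cSupD[OF ne, of "D - e"] \<open>0 < e\<close> by (auto simp: D_def)
      then obtain d1 where d1: "d1 > 0"
        "\<And>u v. u < x \<Longrightarrow> x < v \<Longrightarrow> v - u < d1 \<Longrightarrow> p * (v - u) < f v - f u"
        by (auto simp: S_def low_def not_le)
      \<comment> \<open>Slopes at most \<open>p'\<close> recur because \<open>p'\<close> exceeds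
        \<open>D\<close>. Since \<open>x\<close> avoids the null set indexed by
        \<open>(p', q')\<close>, slopes at least \<open>q'\<close> cannot recur, so all short slopes
        stay below \<open>D + e\<close>.\<close>
      obtain p' where p': "p' \<in> \<rat>" "D < p'" "p' < D + e" using Rats_dense_in_real[of D "D + e"] \<open>0 < e\<close> by auto
      obtain q' where q': "q' \<in> \<rat>" "p' < q'" "q' < D + e" using Rats_dense_in_real[of p' "D + e"] p' by auto
      have "p' \<notin> S" using cSup_upper[OF _ bdd, of p'] p' by (auto simp: D_def)
      then have "low p' x" by (simp add: S_def)
      moreover have "(p', q') \<in> Q" using p' q' D0 by (auto simp: Q_def)
      ultimately have "\<not> upp q' x" using x by force
      then obtain d2 where d2: "d2 > 0"
        "\<And>u v. u < x \<Longrightarrow> x < v \<Longrightarrow> v - u < d2 \<Longrightarrow> f v - f u < q' * (v - u)"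
        by (auto simp: upp_def not_le)
      show "\<exists>d>0. \<forall>u v. u < x \<and> x < v \<and> v - u < d \<longrightarrow> \<bar>f v - f u - D * (v - u)\<bar> \<le> e * (v - u)"
      proof (intro exI[of _ "min d1 d2"] conjI allI impI)
        fix u v assume uv: "u < x \<and> x < v \<and> v - u < min d1 d2"
        then have "p * (v - u) < f v - f u" "f v - f u < q' * (v - u)" using d1 d2 by auto
        moreover have "(D - e) * (v - u) \<le> p * (v - u)" "q' * (v - u) \<le> (D + e) * (v - u)"
          using \<open>D - e < p\<close> q' uv by (auto intro!: mult_right_mono)
        ultimately show "\<bar>f v - f u - D * (v - u)\<bar> \<le> e * (v - u)"
          by (simp add: abs_le_iff algebra_simps)
      qed (use d1 d2 in auto)
    qed
    then show ?thesis using real_differentiable_def by blast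
  qed
  then show ?thesis by (intro negligible_subset[OF neg]) blast
qed

text \<open>The constant extension to the left of 0 is monotone and Lipschitz on the whole line and
  agrees with \<open>g\<close> near every positive time.\<close>

lemma mono_on_lipschitz_ae_differentiable:
  fixes g :: "real \<Rightarrow> real"
  assumes mono: "mono_on {0..} g" and lip: "L-lipschitz_on {0..} g"
  shows "negligible {t. 0 < t \<and> \<not> g differentiable (at t)}"
proof -
  define f where "f t = g (max 0 t)" for t
  have "mono f" using mono by (auto simp: f_def mono_def mono_on_def)
  moreover have "L-lipschitz_on UNIV f"
  proof (rule lipschitz_onI)
    show "0 \<le> L" using lip by (rule lipschitz_on_nonneg)
    fix x y :: real
    have "dist (f x) (f y) \<le> L * dist (max 0 x) (max 0 y)"
      unfolding f_def by (rule lipschitz_onD[OF lip]) auto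
    also have "\<dots> \<le> L * dist x y"
      using \<open>0 \<le> L\<close> by (intro mult_left_mono) (auto simp: dist_real_def)
    finally show "dist (f x) (f y) \<le> L * dist x y" .
  qed
  ultimately have "negligible {x. \<not> f differentiable (at x)}"
    by (rule mono_lipschitz_ae_differentiable)
  then show ?thesis
  proof (rule negligible_subset)
    show "{t. 0 < t \<and> \<not> g differentiable (at t)} \<subseteq> {x. \<not> f differentiable (at x)}"
    proof clarify
      fix t :: real assume t: "0 < t" "\<not> g differentiable (at t)" "f differentiable (at t)"
      then obtain D where "(f has_real_derivative D) (at t)" by (auto simp: real_differentiable_def)
      then have "(g has_real_derivative D) (at t)"
        by (rule has_field_derivative_transform_within_open[where S = "{0<..}"]) (use t in \<open>auto simp: f_def\<close>)
      then show False using t real_differentiable_def by blast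
    qed
  qed
qed

section \<open>Functions that decrease while positive\<close>

text \<open>While positive, \<open>g\<close> loses at least \<open>c\<close> per unit of time, so it
  must reach 0. It cannot become positive again, since it would have decreased ever since its last
  nonpositive time.\<close>

lemma eventually_nonpos_of_decrease:
  fixes g :: "real \<Rightarrow> real"
  assumes cont: "continuous_on {0..} g" and "0 < c"
    and decr: "\<And>a b. 0 \<le> a \<Longrightarrow> a \<le> b \<Longrightarrow> (\<And>t. a < t \<Longrightarrow> t < b \<Longrightarrow> 0 < g t) \<Longrightarrow>
                 g b \<le> g a - c * (b - a)"
  shows "\<exists>t0\<ge>0. \<forall>t\<ge>t0. g t \<le> 0"
proof -
  have "\<exists>t0\<ge>0. g t0 \<le> 0"
  proof (rule ccontr)
    assume neg: "\<not> ?thesis"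
    then have pos: "0 < g t" if "0 \<le> t" for t using that by (meson not_le)
    \<comment> \<open>\<open>g 0 / c\<close> is the time at which the bound
      \<open>g 0 - c * t\<close> reaches 0.\<close>
    have "g (g 0 / c) \<le> g 0 - c * (g 0 / c - 0)"
      using pos[of 0] \<open>0 < c\<close> by (intro decr pos) auto
    then have "g (g 0 / c) \<le> 0" using \<open>0 < c\<close> by simp
    then show False using pos[of "g 0 / c"] pos[of 0] \<open>0 < c\<close> by simp
  qed
  then obtain t0 where t0: "0 \<le> t0" "g t0 \<le> 0" by blast
  have "g t \<le> 0" if "t0 \<le> t" for t
  proof (rule ccontr)
    assume "\<not> g t \<le> 0"
    define S where "S = {s \<in> {t0..t}. g s \<le> 0}"
    have "closed S" unfolding S_def
      using continuous_closed_preimage[OF continuous_on_subset[OF cont, of "{t0..t}"], of "{..0}"] t0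
      by (simp add: vimage_def Int_def)
    moreover have "t0 \<in> S" and bdd: "bdd_above S" using t0 that by (auto simp: S_def)
    ultimately have s: "Sup S \<in> S" by (metis closed_contains_Sup empty_iff)
    then have st: "0 \<le> Sup S" "Sup S \<le> t" "g (Sup S) \<le> 0" "t0 \<le> Sup S" using t0 by (auto simp: S_def)
    have "0 < g u" if "Sup S < u" "u < t" for u
    proof (rule ccontr)
      assume "\<not> 0 < g u"
      then have "u \<in> S" using that st by (auto simp: S_def)
      then show False using cSup_upper[OF _ bdd, of u] that by simp
    qed
    then have "g t \<le> g (Sup S) - c * (t - Sup S)" using st by (intro decr) auto
    moreover have "c * (t - Sup S) \<ge> 0" using st \<open>0 < c\<close> by simp
    ultimately show False using st \<open>\<not> g t \<le> 0\<close> by linarith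
  qed
  then show ?thesis using t0 by blast
qed

text \<open>Adding \<open>(c/2) * t\<close> uses up only half of the decrease, so the derivative
  stays strictly negative, as the comparison lemma demands.\<close>

lemma lipschitz_eventually_nonpos:
  fixes g :: "real \<Rightarrow> real"
  assumes lip: "L-lipschitz_on {0..} g" and N: "negligible N" and "0 < c"
    and deriv: "\<And>t. 0 < t \<Longrightarrow> t \<notin> N \<Longrightarrow> 0 < g t \<Longrightarrow> \<exists>D\<le>-c. (g has_real_derivative D) (at t)"
  shows "\<exists>t0\<ge>0. \<forall>t\<ge>t0. g t \<le> 0"
proof (rule eventually_nonpos_of_decrease[of _ "c/2"])
  show "continuous_on {0..} g" using lip by (rule lipschitz_on_continuous_on)
  fix a b :: real
  assume ab: "0 \<le> a" "a \<le> b" and pos: "\<And>t. a < t \<Longrightarrow> t < b \<Longrightarrow> 0 < g t"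
  have "g b + (c/2) * b \<le> g a + (c/2) * a"
  proof (rule lipschitz_deriv_neg_imp_le[OF ab(2) _ N, where f = "\<lambda>t. g t + (c/2) * t"])
    show "(L + \<bar>c/2\<bar> * 1)-lipschitz_on {a..b} (\<lambda>t. g t + (c/2) * t)"
      by (intro lipschitz_on_add lipschitz_on_cmult_real lipschitz_on_id lipschitz_on_subset[OF lip])
         (use ab in auto)
    fix t assume t: "a < t" "t < b" "t \<notin> N"
    then obtain D where D: "D \<le> -c" "(g has_real_derivative D) (at t)"
      using deriv[of t] pos[of t] ab by auto
    then show "\<exists>D<0. ((\<lambda>t. g t + (c/2) * t) has_real_derivative D) (at t)"
      using \<open>0 < c\<close> by (intro exI[of _ "D + c/2"]) (auto intro!: derivative_eq_intros)
  qed
  then show "g b \<le> g a - (c/2) * (b - a)" by (simp add: field_simps)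
qed (use \<open>0 < c\<close> in simp)

text \<open>Continuous induction: the last point up to which \<open>g t + c * t\<close> has not
  risen above its initial value must be the right endpoint, since the local decrease would otherwise
  carry it further.\<close>

lemma eventually_nonpos_of_local_decrease:
  fixes g :: "real \<Rightarrow> real"
  assumes cont: "continuous_on {0..} g" and "0 < c"
    and loc: "\<And>t. 0 \<le> t \<Longrightarrow> 0 < g t \<Longrightarrow> \<exists>d>0. \<forall>s. t \<le> s \<and> s < t + d \<longrightarrow> g s \<le> g t - c * (s - t)"
  shows "\<exists>t0\<ge>0. \<forall>t\<ge>t0. g t \<le> 0"
proof (rule eventually_nonpos_of_decrease[OF cont \<open>0 < c\<close>])
  fix a b :: real
  assume ab: "0 \<le> a" "a \<le> b" and pos: "\<And>t. a < t \<Longrightarrow> t < b \<Longrightarrow> 0 < g t"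
  define h where "h t = g t + c * t" for t
  have hcont: "continuous_on {0..} h" unfolding h_def using cont by (intro continuous_intros)
  \<comment> \<open>Positivity is known only inside the interval, so the induction starts at an
    interior \<open>a'\<close>, which then tends to \<open>a\<close>.\<close>
  have inner: "h b \<le> h a'" if a': "a < a'" "a' < b" for a'
  proof -
    define S where "S = {s \<in> {a'..b}. h s \<le> h a'}"
    have "closed S" unfolding S_def
      using continuous_closed_preimage[OF continuous_on_subset[OF hcont, of "{a'..b}"], of "{..h a'}"] ab a'
      by (simp add: vimage_def Int_def)
    moreover have "a' \<in> S" and bdd: "bdd_above S" using a' by (auto simp: S_def)
    ultimately have "Sup S \<in> S" by (metis closed_contains_Sup empty_iff)
    then have st: "a' \<le> Sup S" "Sup S \<le> b" "h (Sup S) \<le> h a'" by (auto simp: S_def)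
    have "Sup S = b"
    proof (rule ccontr)
      assume "Sup S \<noteq> b"
      then have lt: "Sup S < b" using st by simp
      then obtain d where d: "d > 0"
        "\<And>s. Sup S \<le> s \<Longrightarrow> s < Sup S + d \<Longrightarrow> g s \<le> g (Sup S) - c * (s - Sup S)"
        using loc[of "Sup S"] pos[of "Sup S"] st ab a' by fastforce
      define s where "s = min (Sup S + d/2) b"
      have s: "Sup S < s" "s < Sup S + d" "s \<le> b" using d lt by (auto simp: s_def)
      then have "h s \<le> h (Sup S)" using d(2)[of s] by (simp add: h_def algebra_simps)
      then have "s \<in> S" using s st by (auto simp: S_def)
      then show False using cSup_upper[OF _ bdd, of s] s by simp
    qed
    then show ?thesis using st by simp
  qed
  have "h b \<le> h a"
  proof (cases "a = b")
    case False
    then have "a < b" using ab by simp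
    have "continuous_on {a..b} h" using ab by (intro continuous_on_subset[OF hcont]) auto
    then have "(h \<longlongrightarrow> h a) (at_right a)"
      using \<open>a < b\<close> by (simp add: continuous_on_Icc_at_rightD)
    moreover have "\<forall>\<^sub>F a' in at_right a. h b \<le> h a'"
      unfolding eventually_at_right_field using inner \<open>a < b\<close> by blast
    ultimately show ?thesis by (intro tendsto_lowerbound) auto
  qed simp
  then show "g b \<le> g a - c * (b - a)" by (simp add: h_def algebra_simps)
qed

section \<open>The matrices of the network\<close>

lemma matrix_inv_eqI:
  fixes A B :: "real^'n^'n"
  assumes "A ** B = mat 1"
  shows "matrix_inv A = B"
  unfolding matrix_inv_def
proof (rule some_equality)
  show "A ** B = mat 1 \<and> B ** A = mat 1" using assms matrix_left_right_inverse by blast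
  fix B' assume "A ** B' = mat 1 \<and> B' ** A = mat 1"
  then show "B' = B" using assms by (metis matrix_mul_assoc matrix_mul_lid matrix_mul_rid)
qed

text \<open>A job in class \<open>l\<close> visits \<open>k\<close> once if \<open>k\<close> is not
  earlier on the route, and never otherwise.\<close>

lemma Qmat_eq: "Qmat = (\<chi> k l. if class_no l \<le> class_no k then 1 else 0)"
  unfolding Qmat_def
  by (rule matrix_inv_eqI)
     (simp add: vec_eq_iff forall_4 matrix_matrix_mult_def sum_4 mat_def transpose_def routing_def class_no_def)

lemma matrix_inv_Mmat:
  assumes "\<forall>k. m $ k > 0"
  shows "matrix_inv (Mmat m) = (\<chi> k l. if k = l then 1 / m $ k else 0)"
  by (rule matrix_inv_eqI)
     (use assms in \<open>simp add: vec_eq_iff forall_4 matrix_matrix_mult_def sum_4 mat_def Mmat_def less_imp_neq\<close>)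

lemma load_components:
  "load \<alpha>1 m $ 1 = (m $ 1 + m $ 4) * \<alpha>1" "load \<alpha>1 m $ 2 = (m $ 2 + m $ 3) * \<alpha>1"
  by (simp_all add: load_def Qmat_eq matrix_vector_mult_def matrix_matrix_mult_def sum_4 Cmat_def Mmat_def
      station_def arrivals_def class_no_def algebra_simps)

lemma ratio_matrix_components:
  assumes "ratio_matrix m \<Delta>"
  shows "\<Delta> $ 1 $ 2 = 0" "\<Delta> $ 4 $ 2 = 0" "\<Delta> $ 2 $ 1 = 0" "\<Delta> $ 3 $ 1 = 0"
    and "\<And>k j. 0 \<le> \<Delta> $ k $ j"
    and "m $ 1 * \<Delta> $ 1 $ 1 + m $ 4 * \<Delta> $ 4 $ 1 = 1"
    and "m $ 2 * \<Delta> $ 2 $ 2 + m $ 3 * \<Delta> $ 3 $ 2 = 1"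
proof -
  have z: "\<And>k j. station k \<noteq> j \<Longrightarrow> \<Delta> $ k $ j = 0" and "Cmat ** Mmat m ** \<Delta> = mat 1"
    using assms by (auto simp: ratio_matrix_def)
  then have "(Cmat ** Mmat m ** \<Delta>) $ 1 $ 1 = 1" "(Cmat ** Mmat m ** \<Delta>) $ 2 $ 2 = 1"
    by (simp_all add: mat_def)
  then show "m $ 1 * \<Delta> $ 1 $ 1 + m $ 4 * \<Delta> $ 4 $ 1 = 1"
    and "m $ 2 * \<Delta> $ 2 $ 2 + m $ 3 * \<Delta> $ 3 $ 2 = 1"
    by (simp_all add: matrix_matrix_mult_def sum_4 Cmat_def Mmat_def station_def)
  show "\<Delta> $ 1 $ 2 = 0" "\<Delta> $ 4 $ 2 = 0" "\<Delta> $ 2 $ 1 = 0" "\<Delta> $ 3 $ 1 = 0"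
    using z by (simp_all add: station_def)
  show "\<And>k j. 0 \<le> \<Delta> $ k $ j" using assms by (simp add: ratio_matrix_def)
qed

text \<open>\<open>G\<close> maps collapsed station workloads to total workloads: for each station,
  all work that the jobs now in the network will still bring to it.\<close>

lemma workload_matrix_components:
  assumes "ratio_matrix m \<Delta>"
  defines "G \<equiv> Cmat ** Mmat m ** Qmat ** \<Delta>"
  shows "G $ 1 $ 1 = (m $ 1 + m $ 4) * \<Delta> $ 1 $ 1 + m $ 4 * \<Delta> $ 4 $ 1"
    and "G $ 1 $ 2 = m $ 4 * (\<Delta> $ 2 $ 2 + \<Delta> $ 3 $ 2)"
    and "G $ 2 $ 1 = (m $ 2 + m $ 3) * \<Delta> $ 1 $ 1"
    and "G $ 2 $ 2 = (m $ 2 + m $ 3) * \<Delta> $ 2 $ 2 + m $ 3 * \<Delta> $ 3 $ 2"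
  using ratio_matrix_components(1-4)[OF assms(1)]
  by (simp_all add: G_def Qmat_eq matrix_matrix_mult_def sum_4 Cmat_def Mmat_def
      station_def class_no_def algebra_simps)

section \<open>The Skorohod problem\<close>

text \<open>A vanishing integral makes the set where \<open>g\<close> is positive null for the
  measure of \<open>F\<close>, and the mass of \<open>{a<..b}\<close> is
  \<open>F b - F a\<close>.\<close>

lemma stieltjes_zero_imp_constant:
  fixes g F :: "real \<Rightarrow> real"
  assumes mono: "mono_on {0..} F" and contF: "continuous_on {0..} F" and contg: "continuous_on {0..} g"
    and zero: "stieltjes_integral g F = 0"
    and ab: "0 \<le> a" "a \<le> b" and pos: "\<And>t. a < t \<Longrightarrow> t \<le> b \<Longrightarrow> 0 < g t"
  shows "F b = F a"
proof -
  define G where "G t = F (max 0 t)" for t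
  have "mono G" using mono by (auto simp: G_def mono_def mono_on_def)
  then have monoG: "\<And>x y. x \<le> y \<Longrightarrow> G x \<le> G y" by (simp add: monoD)
  have "continuous_on UNIV G" unfolding G_def
    by (rule continuous_on_compose2[OF contF]) (auto intro!: continuous_intros)
  then have contG: "\<And>x. continuous (at_right x) G"
    by (auto simp: continuous_on_eq_continuous_within intro: continuous_within_subset)
  have eq: "(\<lambda>t. ennreal (g t) * indicator {0..} t) = (\<lambda>t. ennreal (indicator {0..} t *\<^sub>R g t))"
    by (auto simp: indicator_def)
  have meas: "(\<lambda>t. ennreal (g t) * indicator {0..} t) \<in> borel_measurable (interval_measure G)"
    unfolding eq using borel_measurable_continuous_on_indicator[OF _ contg] by simp
  have "AE t in interval_measure G. ennreal (g t) * indicator {0..} t = 0"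
    using zero nn_integral_0_iff_AE[OF meas] unfolding stieltjes_integral_def G_def by simp
  then have "AE t in interval_measure G. t \<notin> {a<..b}"
  proof eventually_elim
    case (elim t)
    then show ?case using pos[of t] ab by (auto simp: indicator_def split: if_splits)
  qed
  then have "emeasure (interval_measure G) {a<..b} = 0"
    by (subst (asm) AE_iff_null_sets[symmetric]) (auto simp: null_sets_def)
  then have "ennreal (G b - G a) = 0"
    using emeasure_interval_measure_Ioc[OF ab(2) monoG contG] by simp
  then have "G b \<le> G a" by (simp add: ennreal_eq_0_iff)
  then show ?thesis using monoG[OF ab(2)] ab by (simp add: G_def)
qed

text \<open>This controls one component \<open>x\<close> of a maximum \<open>v\<close>. Either
  \<open>w\<close> stays positive for a while and \<open>x\<close> decreases by assumption, or
  \<open>x\<close> is strictly below \<open>v\<close> and continuity leaves room for a short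
  time.\<close>

lemma local_decrease_of_complementarity:
  fixes x w :: "real \<Rightarrow> real"
  assumes contx: "continuous_on {0..} x" and contw: "continuous_on {0..} w"
    and t: "0 \<le> t" "x t \<le> v" and or: "0 < w t \<or> x t < v"
    and decr: "\<And>b. t \<le> b \<Longrightarrow> (\<And>s. t < s \<Longrightarrow> s \<le> b \<Longrightarrow> 0 < w s) \<Longrightarrow> x b \<le> x t - r * (b - t)"
  shows "\<exists>d>0. \<forall>s. t \<le> s \<and> s < t + d \<longrightarrow> x s \<le> v - r * (s - t)"
  using or
proof
  assume "0 < w t"
  then have "\<exists>d>0. \<forall>s\<in>{0..}. dist s t < d \<longrightarrow> dist (w s) (w t) < w t"
    using contw t unfolding continuous_on_iff by (metis atLeast_iff)
  then obtain d where d: "d > 0" "\<And>s. 0 \<le> s \<Longrightarrow> dist s t < d \<Longrightarrow> dist (w s) (w t) < w t" by auto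
  have pos: "0 < w s" if "t \<le> s" "s < t + d" for s
    using d(2)[of s] that t by (auto simp: dist_real_def)
  have "x s \<le> v - r * (s - t)" if "t \<le> s" "s < t + d" for s
    using decr[of s] pos that t(2) by fastforce
  then show ?thesis using d(1) by blast
next
  assume lt: "x t < v"
  define y where "y s = x s + r * (s - t)" for s
  have "continuous_on {0..} y" unfolding y_def using contx by (intro continuous_intros)
  moreover have "0 < v - y t" using lt by (simp add: y_def)
  ultimately have "\<exists>d>0. \<forall>s\<in>{0..}. dist s t < d \<longrightarrow> dist (y s) (y t) < v - y t"
    using t unfolding continuous_on_iff by (metis atLeast_iff)
  then obtain d where d: "d > 0" "\<And>s. 0 \<le> s \<Longrightarrow> dist s t < d \<Longrightarrow> dist (y s) (y t) < v - y t" by auto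
  have "x s \<le> v - r * (s - t)" if "t \<le> s" "s < t + d" for s
  proof -
    have "dist (y s) (y t) < v - y t" using d(2)[of s] that t by (simp add: dist_real_def)
    then have "y s < v" by (simp add: dist_real_def)
    then show ?thesis by (simp add: y_def)
  qed
  then show ?thesis using d(1) by blast
qed

text \<open>The Lyapunov function is \<open>max U\<^sub>1 (\<kappa> U\<^sub>2)\<close> with \<open>U = G W\<close>. The component \<open>U\<^sub>j\<close> decreases at
  rate \<open>c\<close> as long as \<open>W\<^sub>j > 0\<close>, and \<open>G\<^sub>1\<^sub>2 / G\<^sub>2\<^sub>2 < \<kappa> < 1\<close> ensures that a component with \<open>W\<^sub>j = 0\<close>
  does not attain the maximum.\<close>

lemma SP_stable_of_inverse:
  fixes G R :: "real^2^2"
  assumes inv: "G ** R = mat 1" and drift: "\<And>j. (G *v \<theta>) $ j = - c" and "0 < c"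
    and G: "0 < G $ 1 $ 1" "0 < G $ 1 $ 2" "0 \<le> G $ 2 $ 1" "G $ 2 $ 1 \<le> G $ 1 $ 1" "G $ 1 $ 2 < G $ 2 $ 2"
  shows "SP_stable R \<theta>"
  unfolding SP_stable_def
proof (intro allI impI)
  fix Y W assume "SP_solution R \<theta> Y W"
  then have contY: "continuous_on {0..} Y" and contW: "continuous_on {0..} W"
    and W: "\<And>t. 0 \<le> t \<Longrightarrow> W t = W 0 + t *\<^sub>R \<theta> + R *v Y t"
    and nonneg: "\<And>t j. 0 \<le> t \<Longrightarrow> 0 \<le> W t $ j"
    and mono: "\<And>j. mono_on {0..} (\<lambda>t. Y t $ j)"
    and compl: "\<And>j. stieltjes_integral (\<lambda>t. W t $ j) (\<lambda>t. Y t $ j) = 0"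
    unfolding SP_solution_def by blast+
  define U where "U t = G *v W t" for t
  \<comment> \<open>The midpoint between \<open>G $ 1 $ 2 / G $ 2 $ 2\<close> and 1.\<close>
  define \<kappa> where "\<kappa> = (G $ 1 $ 2 / G $ 2 $ 2 + 1) / 2"
  have \<kappa>: "0 < \<kappa>" "\<kappa> < 1" "G $ 1 $ 2 < \<kappa> * G $ 2 $ 2" using G by (auto simp: \<kappa>_def field_simps)
  have \<kappa>21: "\<kappa> * G $ 2 $ 1 < G $ 1 $ 1"
  proof -
    have "\<kappa> * G $ 2 $ 1 \<le> \<kappa> * G $ 1 $ 1" using G \<kappa> by simp
    also have "\<dots> < 1 * G $ 1 $ 1" using G \<kappa> by (intro mult_strict_right_mono) auto
    finally show ?thesis by simp
  qed
  have U1: "U t $ 1 = G $ 1 $ 1 * W t $ 1 + G $ 1 $ 2 * W t $ 2"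
    and U2: "U t $ 2 = G $ 2 $ 1 * W t $ 1 + G $ 2 $ 2 * W t $ 2" for t
    by (simp_all add: U_def matrix_vector_mult_def sum_2)
  \<comment> \<open>Multiplication by \<open>G\<close> cancels the reflection matrix, so
    \<open>Y t $ j\<close> alone pushes the component \<open>j\<close>.\<close>
  have Ueq: "U t $ j = U 0 $ j - c * t + Y t $ j" if "0 \<le> t" for t j
  proof -
    have "U t = G *v W 0 + t *\<^sub>R (G *v \<theta>) + (G ** R) *v Y t"
      unfolding U_def by (subst W[OF that])
        (simp add: matrix_vector_right_distrib matrix_vector_mult_scaleR matrix_vector_mul_assoc)
    then show ?thesis by (simp add: inv drift U_def)
  qed
  have decrU: "U b $ j = U a $ j - c * (b - a)"
    if "0 \<le> a" "a \<le> b" "\<And>s. a < s \<Longrightarrow> s \<le> b \<Longrightarrow> 0 < W s $ j" for a b j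
  proof -
    have "Y b $ j = Y a $ j"
      by (rule stieltjes_zero_imp_constant[OF mono _ _ compl])
         (use that contY contW in \<open>auto intro!: continuous_intros\<close>)
    then show ?thesis using that Ueq[of a j] Ueq[of b j] by (simp add: algebra_simps)
  qed
  define V where "V t = max (U t $ 1) (\<kappa> * U t $ 2)" for t
  have contU: "continuous_on {0..} (\<lambda>t. U t $ j)" for j
    unfolding U_def matrix_vector_mult_def using contW by (simp add: sum_2) (intro continuous_intros)
  have "\<exists>t0\<ge>0. \<forall>t\<ge>t0. V t \<le> 0"
  proof (rule eventually_nonpos_of_local_decrease[of _ "\<kappa> * c"])
    show "continuous_on {0..} V" unfolding V_def by (intro continuous_on_max continuous_on_mult_left contU)
    show "0 < \<kappa> * c" using \<kappa> \<open>0 < c\<close> by simp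
    fix t :: real assume t: "0 \<le> t" "0 < V t"
    have W0: "\<not> (W t $ 1 = 0 \<and> W t $ 2 = 0)" using t(2) by (auto simp: V_def U1 U2)
    \<comment> \<open>Here \<open>U t $ 1\<close> is \<open>G $ 1 $ 2 * W t $ 2\<close>, which is
      less than \<open>\<kappa> * G $ 2 $ 2 * W t $ 2\<close>, the second entry of the
      maximum.\<close>
    have "U t $ 1 < V t" if "W t $ 1 = 0"
    proof -
      have "0 < W t $ 2" using W0 that nonneg[OF t(1), of 2] by auto
      then have "G $ 1 $ 2 * W t $ 2 < \<kappa> * G $ 2 $ 2 * W t $ 2" using \<kappa> by simp
      then show ?thesis using that by (simp add: V_def U1 U2 less_max_iff_disj mult.assoc)
    qed
    then have or1: "0 < W t $ 1 \<or> U t $ 1 < V t" using nonneg[OF t(1), of 1] by fastforce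
    have "\<kappa> * U t $ 2 < V t" if "W t $ 2 = 0"
    proof -
      have "0 < W t $ 1" using W0 that nonneg[OF t(1), of 1] by auto
      then have "\<kappa> * G $ 2 $ 1 * W t $ 1 < G $ 1 $ 1 * W t $ 1" using \<kappa>21 by simp
      then show ?thesis using that by (simp add: V_def U1 U2 less_max_iff_disj mult.assoc)
    qed
    then have or2: "0 < W t $ 2 \<or> \<kappa> * U t $ 2 < V t" using nonneg[OF t(1), of 2] by fastforce
    have "\<exists>d>0. \<forall>s. t \<le> s \<and> s < t + d \<longrightarrow> U s $ 1 \<le> V t - \<kappa> * c * (s - t)"
    proof (rule local_decrease_of_complementarity[where x = "\<lambda>s. U s $ 1" and w = "\<lambda>s. W s $ 1", OF contU _ t(1) _ or1])
      fix b assume b: "t \<le> b" "\<And>s. t < s \<Longrightarrow> s \<le> b \<Longrightarrow> 0 < W s $ 1"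
      have "\<kappa> * (c * (b - t)) \<le> 1 * (c * (b - t))"
        using b(1) \<kappa> \<open>0 < c\<close> by (intro mult_right_mono) auto
      then show "U b $ 1 \<le> U t $ 1 - \<kappa> * c * (b - t)"
        using decrU[OF t(1) b] by (simp add: mult.assoc)
    qed (use contW in \<open>auto simp: V_def intro!: continuous_on_component\<close>)
    then obtain d1 where d1: "d1 > 0" "\<And>s. t \<le> s \<Longrightarrow> s < t + d1 \<Longrightarrow> U s $ 1 \<le> V t - \<kappa> * c * (s - t)"
      by blast
    have "\<exists>d>0. \<forall>s. t \<le> s \<and> s < t + d \<longrightarrow> \<kappa> * U s $ 2 \<le> V t - \<kappa> * c * (s - t)"
    proof (rule local_decrease_of_complementarity[where x = "\<lambda>s. \<kappa> * U s $ 2" and w = "\<lambda>s. W s $ 2", OF _ _ t(1) _ or2])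
      fix b assume b: "t \<le> b" "\<And>s. t < s \<Longrightarrow> s \<le> b \<Longrightarrow> 0 < W s $ 2"
      have "\<kappa> * U b $ 2 = \<kappa> * (U t $ 2 - c * (b - t))" by (simp only: decrU[OF t(1) b])
      then show "\<kappa> * U b $ 2 \<le> \<kappa> * U t $ 2 - \<kappa> * c * (b - t)" by (simp add: right_diff_distrib mult.assoc)
    qed (use contW in \<open>auto simp: V_def intro!: continuous_on_mult_left contU continuous_on_component\<close>)
    then obtain d2 where d2: "d2 > 0" "\<And>s. t \<le> s \<Longrightarrow> s < t + d2 \<Longrightarrow> \<kappa> * U s $ 2 \<le> V t - \<kappa> * c * (s - t)"
      by blast
    show "\<exists>d>0. \<forall>s. t \<le> s \<and> s < t + d \<longrightarrow> V s \<le> V t - \<kappa> * c * (s - t)"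
      using d1 d2 by (intro exI[of _ "min d1 d2"]) (auto simp: V_def[of s for s])
  qed
  then obtain t0 where t0: "0 \<le> t0" "\<And>t. t0 \<le> t \<Longrightarrow> V t \<le> 0" by blast
  \<comment> \<open>The first component of \<open>U\<close> alone suffices: it weights both
    workloads positively.\<close>
  have "W t = 0" if "t0 \<le> t" for t
  proof -
    have "0 \<le> t" using that t0 by simp
    then have w: "0 \<le> W t $ 1" "0 \<le> W t $ 2" using nonneg by auto
    have "G $ 1 $ 1 * W t $ 1 + G $ 1 $ 2 * W t $ 2 \<le> 0"
      using t0(2)[OF that] by (simp add: V_def U1)
    moreover have "0 \<le> G $ 1 $ 1 * W t $ 1" "0 \<le> G $ 1 $ 2 * W t $ 2" using w G by simp_all
    ultimately have "G $ 1 $ 1 * W t $ 1 = 0" "G $ 1 $ 2 * W t $ 2 = 0" by linarith+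
    then show ?thesis using G by (simp add: vec_eq_iff forall_2)
  qed
  then show "\<exists>T\<ge>0. \<forall>t\<ge>T. W t = 0" using t0(1) by blast
qed

section \<open>State-space collapse\<close>

lemma lipschitz_on_vec_nth:
  fixes f :: "real \<Rightarrow> real^'n"
  assumes "L-lipschitz_on X f"
  shows "L-lipschitz_on X (\<lambda>x. f x $ k)"
proof (rule lipschitz_onI)
  show "0 \<le> L" using assms by (rule lipschitz_on_nonneg)
  fix x y assume "x \<in> X" "y \<in> X"
  then show "dist (f x $ k) (f y $ k) \<le> L * dist x y"
    using lipschitz_onD[OF assms] dist_vec_nth_le order_trans by blast
qed

lemma differentiable_vec_nth:
  fixes f :: "real \<Rightarrow> real^'n"
  assumes "\<And>k. (\<lambda>x. f x $ k) differentiable (at t)"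
  shows "f differentiable (at t)"
proof (subst differentiable_componentwise_within, rule ballI)
  fix i :: "real^'n" assume "i \<in> Basis"
  then obtain k where "i = axis k 1" by (auto simp: Basis_vec_def)
  then show "(\<lambda>x. f x \<bullet> i) differentiable (at t)" using assms[of k] by (simp add: inner_axis)
qed

section \<open>Rates of a fluid solution\<close>

lemma fluid_solutionD:
  assumes "fluid_solution \<alpha>1 m \<Delta> Z W \<epsilon> T Y"
  shows "\<exists>L. L-lipschitz_on {0..} Z"
    and "\<exists>L. L-lipschitz_on {0..} T"
    and "\<forall>t\<ge>0. Z t = Z 0 + t *\<^sub>R arrivals \<alpha>1
                 - ((mat 1 - transpose routing) ** matrix_inv (Mmat m)) *v T t"
    and "\<forall>t\<ge>0. \<forall>k. 0 \<le> Z t $ k"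
    and "\<forall>t\<ge>0. W t = (Cmat ** Mmat m) *v Z t"
    and "\<forall>t\<ge>0. \<epsilon> t = Z t - \<Delta> *v W t"
    and "\<forall>k. mono_on {0..} (\<lambda>t. T t $ k)"
    and "\<forall>t\<ge>0. Y t = t *\<^sub>R (\<chi> j. 1) - Cmat *v T t"
    and "\<forall>j. mono_on {0..} (\<lambda>t. Y t $ j)"
    and "\<forall>k. \<forall>t>0. T differentiable (at t) \<longrightarrow>
        (\<Sum>i\<in>pos_classes_upto (\<epsilon> t) k. \<epsilon> t $ i) *
        (1 - (\<Sum>i\<in>pos_classes_upto (\<epsilon> t) k. vector_derivative T (at t) $ i)) = 0"
  by (insert assms, unfold fluid_solution_def, (elim conjE, assumption)+)

lemma fluid_ae_differentiable:
  assumes "fluid_solution \<alpha>1 m \<Delta> Z W \<epsilon> T Y"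
  shows "negligible {t. 0 < t \<and> \<not> T differentiable (at t)}"
proof -
  obtain L where "L-lipschitz_on {0..} T" using fluid_solutionD(2)[OF assms] by blast
  moreover note fluid_solutionD(7)[OF assms]
  ultimately have "negligible (\<Union>k. {t. 0 < t \<and> \<not> (\<lambda>t. T t $ k) differentiable (at t)})"
    by (intro negligible_Union) (auto intro: mono_on_lipschitz_ae_differentiable lipschitz_on_vec_nth)
  then show ?thesis
    by (rule negligible_subset) (auto intro: differentiable_vec_nth)
qed

text \<open>Class \<open>k\<close> departs at rate \<open>\<tau> $ k / m $ k\<close> and feeds the
  next class. The bounds on \<open>\<tau>\<close> are the monotonicity of \<open>T\<close> and of
  the idle time \<open>Y\<close>.\<close>

lemma fluid_derivatives:
  fixes T :: "real \<Rightarrow> real^4"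
  assumes fl: "fluid_solution \<alpha>1 m \<Delta> Z W \<epsilon> T Y" and m: "\<forall>k. m $ k > 0"
    and t: "0 < t" "T differentiable (at t)"
  defines "\<tau> \<equiv> vector_derivative T (at t)"
  shows "\<And>k. 0 \<le> \<tau> $ k" "\<tau> $ 1 + \<tau> $ 4 \<le> 1" "\<tau> $ 2 + \<tau> $ 3 \<le> 1"
    and "((\<lambda>t. Z t $ 1) has_real_derivative \<alpha>1 - \<tau> $ 1 / m $ 1) (at t)"
    and "((\<lambda>t. Z t $ 2) has_real_derivative \<tau> $ 1 / m $ 1 - \<tau> $ 2 / m $ 2) (at t)"
    and "((\<lambda>t. Z t $ 3) has_real_derivative \<tau> $ 2 / m $ 2 - \<tau> $ 3 / m $ 3) (at t)"
    and "((\<lambda>t. Z t $ 4) has_real_derivative \<tau> $ 3 / m $ 3 - \<tau> $ 4 / m $ 4) (at t)"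
proof -
  have Z: "Z s = Z 0 + s *\<^sub>R arrivals \<alpha>1 - ((mat 1 - transpose routing) ** matrix_inv (Mmat m)) *v T s"
    if "0 \<le> s" for s using fluid_solutionD(3)[OF fl] that by blast
  have Zk: "Z s $ 1 = Z 0 $ 1 + s * \<alpha>1 - T s $ 1 / m $ 1"
    "Z s $ 2 = Z 0 $ 2 + T s $ 1 / m $ 1 - T s $ 2 / m $ 2"
    "Z s $ 3 = Z 0 $ 3 + T s $ 2 / m $ 2 - T s $ 3 / m $ 3"
    "Z s $ 4 = Z 0 $ 4 + T s $ 3 / m $ 3 - T s $ 4 / m $ 4" if "0 \<le> s" for s
    using arg_cong[OF Z[OF that], of "\<lambda>v. v $ 1"] arg_cong[OF Z[OF that], of "\<lambda>v. v $ 2"]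
      arg_cong[OF Z[OF that], of "\<lambda>v. v $ 3"] arg_cong[OF Z[OF that], of "\<lambda>v. v $ 4"]
    by (simp_all add: matrix_inv_Mmat[OF m] arrivals_def matrix_vector_mult_def matrix_matrix_mult_def
        sum_4 mat_def transpose_def routing_def)
  have Y: "Y s = s *\<^sub>R (\<chi> j. 1) - Cmat *v T s" if "0 \<le> s" for s
    using fluid_solutionD(8)[OF fl] that by blast
  have Yj: "Y s $ 1 = s - (T s $ 1 + T s $ 4)" "Y s $ 2 = s - (T s $ 2 + T s $ 3)" if "0 \<le> s" for s
    by (simp_all add: Y[OF that] matrix_vector_mult_def sum_4 Cmat_def station_def)
  have monoT: "\<And>k. mono_on {0..} (\<lambda>t. T t $ k)" and monoY: "\<And>j. mono_on {0..} (\<lambda>t. Y t $ j)"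
    using fluid_solutionD(7,9)[OF fl] by auto
  have "(T has_vector_derivative \<tau>) (at t)"
    using t(2) unfolding \<tau>_def by (simp add: vector_derivative_works)
  then have dT: "((\<lambda>t. T t $ k) has_real_derivative \<tau> $ k) (at t)" for k
    using bounded_linear.has_vector_derivative[OF bounded_linear_vec_nth]
    by (simp add: has_real_derivative_iff_has_vector_derivative)
  have int: "t \<in> interior {0..}" using t by simp
  show "0 \<le> \<tau> $ k" for k using mono_on_imp_deriv_nonneg[OF monoT dT int] .
  \<comment> \<open>The equations hold only for nonnegative times, which include a neighbourhood of
    the positive time \<open>t\<close>.\<close>
  have transfer: "(f has_real_derivative D) (at t)"
    if "(g has_real_derivative D) (at t)" "\<And>s. 0 \<le> s \<Longrightarrow> f s = g s" for f g :: "real \<Rightarrow> real" and D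
    by (rule has_field_derivative_transform_within_open[OF that(1), of "{0<..}"]) (use t that(2) in auto)
  have "((\<lambda>t. Y t $ 1) has_real_derivative 1 - (\<tau> $ 1 + \<tau> $ 4)) (at t)"
    by (rule transfer[where g = "\<lambda>s. s - (T s $ 1 + T s $ 4)"]) (auto intro!: derivative_eq_intros dT simp: Yj)
  then show "\<tau> $ 1 + \<tau> $ 4 \<le> 1" using mono_on_imp_deriv_nonneg[OF monoY _ int] by force
  have "((\<lambda>t. Y t $ 2) has_real_derivative 1 - (\<tau> $ 2 + \<tau> $ 3)) (at t)"
    by (rule transfer[where g = "\<lambda>s. s - (T s $ 2 + T s $ 3)"]) (auto intro!: derivative_eq_intros dT simp: Yj)
  then show "\<tau> $ 2 + \<tau> $ 3 \<le> 1" using mono_on_imp_deriv_nonneg[OF monoY _ int] by force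
  have m0: "m $ k \<noteq> 0" for k using m by (simp add: less_imp_neq[symmetric])
  show "((\<lambda>t. Z t $ 1) has_real_derivative \<alpha>1 - \<tau> $ 1 / m $ 1) (at t)"
    by (rule transfer[OF _ Zk(1)]) (auto intro!: derivative_eq_intros dT DERIV_cdivide simp: m0)
  show "((\<lambda>t. Z t $ 2) has_real_derivative \<tau> $ 1 / m $ 1 - \<tau> $ 2 / m $ 2) (at t)"
    by (rule transfer[OF _ Zk(2)]) (auto intro!: derivative_eq_intros dT DERIV_cdivide simp: m0)
  show "((\<lambda>t. Z t $ 3) has_real_derivative \<tau> $ 2 / m $ 2 - \<tau> $ 3 / m $ 3) (at t)"
    by (rule transfer[OF _ Zk(3)]) (auto intro!: derivative_eq_intros dT DERIV_cdivide simp: m0)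
  show "((\<lambda>t. Z t $ 4) has_real_derivative \<tau> $ 3 / m $ 3 - \<tau> $ 4 / m $ 4) (at t)"
    by (rule transfer[OF _ Zk(4)]) (auto intro!: derivative_eq_intros dT DERIV_cdivide simp: m0)
qed

text \<open>With the other class in deficit, \<open>k\<close> is the only positive class up to
  \<open>k\<close>, whichever of the two comes first on the route, so the policy equation leaves
  only \<open>\<tau> $ k = 1\<close>.\<close>

lemma fluid_priority:
  assumes fl: "fluid_solution \<alpha>1 m \<Delta> Z W \<epsilon> T Y" and t: "0 < t" "T differentiable (at t)"
    and opposite: "station k = station l" "\<epsilon> t $ l < 0" "0 < \<epsilon> t $ k"
    and only: "\<And>i. station i = station k \<Longrightarrow> i = k \<or> i = l"
  shows "vector_derivative T (at t) $ k = 1"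
proof -
  have "pos_classes_upto (\<epsilon> t) k = {k}"
    using opposite only by (fastforce simp: pos_classes_upto_def)
  moreover have "(\<Sum>i\<in>pos_classes_upto (\<epsilon> t) k. \<epsilon> t $ i) *
        (1 - (\<Sum>i\<in>pos_classes_upto (\<epsilon> t) k. vector_derivative T (at t) $ i)) = 0"
    using fluid_solutionD(10)[OF fl] t by blast
  ultimately show ?thesis using opposite by simp
qed

text \<open>A class in excess drains at full speed. Class 1 drains at \<open>1 / m $ 1\<close>,
  above the arrival rate; class 4 at \<open>1 / m $ 4\<close>, above its largest inflow
  \<open>1 / m $ 3\<close>; class 2 at \<open>1 / m $ 2\<close>, above \<open>1 / m $ 1\<close>;
  class 3 receives nothing, as class 2 is then not served.\<close>

lemma SSC_of_fast_feedback:
  assumes m: "\<forall>k. m $ k > 0" and load: "0 \<le> \<alpha>1" "\<alpha>1 * m $ 1 < 1"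
    and fast: "m $ 2 < m $ 1" "m $ 4 < m $ 3" and ratio: "ratio_matrix m \<Delta>"
  shows "SSC \<alpha>1 m \<Delta>"
  unfolding SSC_def
proof (intro allI impI)
  fix Z W \<epsilon> T Y assume fl: "fluid_solution \<alpha>1 m \<Delta> Z W \<epsilon> T Y"
  note \<Delta> = ratio_matrix_components[OF ratio]
  define a b c d where "a = \<Delta> $ 1 $ 1" and "b = \<Delta> $ 4 $ 1" and "c = \<Delta> $ 2 $ 2" and "d = \<Delta> $ 3 $ 2"
  have nn: "0 \<le> a" "0 \<le> b" "0 \<le> c" "0 \<le> d" using \<Delta>(5) by (auto simp: a_def b_def c_def d_def)
  have ab: "m $ 1 * a + m $ 4 * b = 1" and cd: "m $ 2 * c + m $ 3 * d = 1"
    using \<Delta>(6,7) by (simp_all add: a_def b_def c_def d_def)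
  have mpos: "0 < m $ k" for k using m by simp
  define x where "x t = b * Z t $ 1 - a * Z t $ 4" for t
  define y where "y t = d * Z t $ 2 - c * Z t $ 3" for t
  have Znn: "0 \<le> Z t $ k" if "0 \<le> t" for t k using fluid_solutionD(4)[OF fl] that by blast
  have Weq: "W t = (Cmat ** Mmat m) *v Z t" if "0 \<le> t" for t
    using fluid_solutionD(5)[OF fl] that by blast
  have W: "W t $ 1 = m $ 1 * Z t $ 1 + m $ 4 * Z t $ 4" "W t $ 2 = m $ 2 * Z t $ 2 + m $ 3 * Z t $ 3"
    if "0 \<le> t" for t
    by (simp_all add: Weq[OF that] matrix_vector_mult_def matrix_matrix_mult_def sum_4 Cmat_def Mmat_def station_def)
  have \<epsilon>eq: "\<epsilon> t = Z t - \<Delta> *v W t" if "0 \<le> t" for t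
    using fluid_solutionD(6)[OF fl] that by blast
  have \<epsilon>: "\<epsilon> t $ 1 = m $ 4 * x t" "\<epsilon> t $ 4 = - (m $ 1 * x t)"
    "\<epsilon> t $ 2 = m $ 3 * y t" "\<epsilon> t $ 3 = - (m $ 2 * y t)" if "0 \<le> t" for t
  proof -
    \<comment> \<open>Each \<open>Z\<close> term is multiplied by 1, written as the normalization of
      its station, so that the class's own contribution to \<open>W\<close> cancels.\<close>
    have "\<epsilon> t $ 1 = (m $ 1 * a + m $ 4 * b) * Z t $ 1 - a * W t $ 1"
      "\<epsilon> t $ 4 = (m $ 1 * a + m $ 4 * b) * Z t $ 4 - b * W t $ 1"
      "\<epsilon> t $ 2 = (m $ 2 * c + m $ 3 * d) * Z t $ 2 - c * W t $ 2"
      "\<epsilon> t $ 3 = (m $ 2 * c + m $ 3 * d) * Z t $ 3 - d * W t $ 2"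
      unfolding ab cd using \<Delta>(1-4)
      by (simp_all add: \<epsilon>eq[OF that] matrix_vector_mult_def sum_2 a_def b_def c_def d_def)
    then show "\<epsilon> t $ 1 = m $ 4 * x t" "\<epsilon> t $ 4 = - (m $ 1 * x t)"
      "\<epsilon> t $ 2 = m $ 3 * y t" "\<epsilon> t $ 3 = - (m $ 2 * y t)"
      unfolding x_def y_def W[OF that] by (simp_all only:) (simp_all add: algebra_simps)
  qed
  define N where "N = {t. 0 < t \<and> \<not> T differentiable (at t)}"
  have N: "negligible N" unfolding N_def using fl by (rule fluid_ae_differentiable)
  obtain L where L: "L-lipschitz_on {0..} Z" using fluid_solutionD(1)[OF fl] by blast
  have lip: "(\<bar>u\<bar> * L + \<bar>v\<bar> * L)-lipschitz_on {0..} (\<lambda>t. u * Z t $ i - v * Z t $ j)" for u v i j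
    by (intro lipschitz_on_diff lipschitz_on_cmult_real lipschitz_on_vec_nth L)
  have lipx: "\<exists>L. L-lipschitz_on {0..} x" and lipy: "\<exists>L. L-lipschitz_on {0..} y"
    unfolding x_def y_def by (rule exI, rule lip)+
  have st: "station i = station 1 \<Longrightarrow> i = 1 \<or> i = 4" "station i = station 4 \<Longrightarrow> i = 4 \<or> i = 1"
    "station i = station 2 \<Longrightarrow> i = 2 \<or> i = 3" "station i = station 3 \<Longrightarrow> i = 3 \<or> i = 2" for i
    using exhaust_4[of i] by (auto simp: station_def)

  have rates: "(0 < x t \<longrightarrow> (\<exists>D\<le>- (b * (1 / m $ 1 - \<alpha>1)). (x has_real_derivative D) (at t))) \<and>
      (x t < 0 \<longrightarrow> (\<exists>D\<ge>a * (1 / m $ 4 - 1 / m $ 3). (x has_real_derivative D) (at t))) \<and>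
      (0 < y t \<longrightarrow> (\<exists>D\<le>- (d * (1 / m $ 2 - 1 / m $ 1)). (y has_real_derivative D) (at t))) \<and>
      (y t < 0 \<longrightarrow> (\<exists>D\<ge>c / m $ 3. (y has_real_derivative D) (at t)))"
    if "0 < t" "t \<notin> N" for t
  proof -
    have diff: "T differentiable (at t)" using that by (simp add: N_def)
    define \<tau> where "\<tau> = vector_derivative T (at t)"
    note der = fluid_derivatives[OF fl m that(1) diff, folded \<tau>_def]
    note prio = fluid_priority[OF fl that(1) diff, folded \<tau>_def]
    define Dx where "Dx = b * (\<alpha>1 - \<tau> $ 1 / m $ 1) - a * (\<tau> $ 3 / m $ 3 - \<tau> $ 4 / m $ 4)"
    define Dy where "Dy = d * (\<tau> $ 1 / m $ 1 - \<tau> $ 2 / m $ 2) - c * (\<tau> $ 2 / m $ 2 - \<tau> $ 3 / m $ 3)"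
    have dx: "(x has_real_derivative Dx) (at t)"
      unfolding x_def Dx_def by (intro DERIV_diff DERIV_cmult der)
    have dy: "(y has_real_derivative Dy) (at t)"
      unfolding y_def Dy_def by (intro DERIV_diff DERIV_cmult der)
    have "\<tau> $ 1 \<le> 1" "\<tau> $ 3 \<le> 1" using der(2,3) der(1)[of 4] der(1)[of 2] by linarith+
    then have \<tau>13: "0 \<le> \<tau> $ 1 / m $ 1" "\<tau> $ 1 / m $ 1 \<le> 1 / m $ 1" "0 \<le> \<tau> $ 3 / m $ 3" "\<tau> $ 3 / m $ 3 \<le> 1 / m $ 3"
      using der(1) mpos by (simp_all add: less_imp_le divide_right_mono)
    show ?thesis
    proof (intro conjI impI)
      assume pos: "0 < x t"
      have "\<epsilon> t $ 4 < 0" "0 < \<epsilon> t $ 1" using pos that(1) mpos by (simp_all add: \<epsilon> mult_pos_neg)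
      then have "\<tau> $ 1 = 1" by (intro prio[OF _ _ _ st(1)]) (simp_all add: station_def)
      moreover then have "\<tau> $ 4 = 0" using der(1)[of 4] der(2) by simp
      moreover have "0 \<le> a * (\<tau> $ 3 / m $ 3)" using nn \<tau>13 by (intro mult_nonneg_nonneg)
      ultimately have "Dx \<le> - (b * (1 / m $ 1 - \<alpha>1))" by (simp add: Dx_def algebra_simps)
      then show "\<exists>D\<le>- (b * (1 / m $ 1 - \<alpha>1)). (x has_real_derivative D) (at t)" using dx by blast
    next
      assume neg: "x t < 0"
      have "\<epsilon> t $ 1 < 0" "0 < \<epsilon> t $ 4" using neg that(1) mpos by (simp_all add: \<epsilon> mult_pos_neg)
      then have "\<tau> $ 4 = 1" by (intro prio[OF _ _ _ st(2)]) (simp_all add: station_def)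
      moreover then have "\<tau> $ 1 = 0" using der(1)[of 1] der(2) by simp
      moreover have "a * (\<tau> $ 3 / m $ 3) \<le> a * (1 / m $ 3)" using nn \<tau>13 by (intro mult_left_mono) auto
      moreover have "0 \<le> b * \<alpha>1" using nn load by simp
      ultimately have "Dx \<ge> a * (1 / m $ 4 - 1 / m $ 3)" by (simp add: Dx_def algebra_simps)
      then show "\<exists>D\<ge>a * (1 / m $ 4 - 1 / m $ 3). (x has_real_derivative D) (at t)" using dx by blast
    next
      assume pos: "0 < y t"
      have "\<epsilon> t $ 3 < 0" "0 < \<epsilon> t $ 2" using pos that(1) mpos by (simp_all add: \<epsilon> mult_pos_neg)
      then have "\<tau> $ 2 = 1" by (intro prio[OF _ _ _ st(3)]) (simp_all add: station_def)
      moreover then have "\<tau> $ 3 = 0" using der(1)[of 3] der(3) by simp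
      moreover have "d * (\<tau> $ 1 / m $ 1) \<le> d * (1 / m $ 1)" using nn \<tau>13 by (intro mult_left_mono) auto
      moreover have "0 \<le> c * (1 / m $ 2)" using nn mpos by (simp add: less_imp_le)
      ultimately have "Dy \<le> - (d * (1 / m $ 2 - 1 / m $ 1))" by (simp add: Dy_def algebra_simps)
      then show "\<exists>D\<le>- (d * (1 / m $ 2 - 1 / m $ 1)). (y has_real_derivative D) (at t)" using dy by blast
    next
      assume neg: "y t < 0"
      have "\<epsilon> t $ 2 < 0" "0 < \<epsilon> t $ 3" using neg that(1) mpos by (simp_all add: \<epsilon> mult_pos_neg)
      then have "\<tau> $ 3 = 1" by (intro prio[OF _ _ _ st(4)]) (simp_all add: station_def)
      moreover then have "\<tau> $ 2 = 0" using der(1)[of 2] der(3) by simp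
      moreover have "0 \<le> d * (\<tau> $ 1 / m $ 1)" using nn \<tau>13 by (intro mult_nonneg_nonneg)
      ultimately have "Dy \<ge> c / m $ 3" by (simp add: Dy_def algebra_simps)
      then show "\<exists>D\<ge>c / m $ 3. (y has_real_derivative D) (at t)" using dy by blast
    qed
  qed
  \<comment> \<open>The drift bound \<open>k * r\<close> degenerates when the ratio entry
    \<open>k\<close> is 0, but then nonnegativity of \<open>Z\<close> already fixes the sign of
    \<open>g\<close>.\<close>
  have ends: "\<exists>t0\<ge>0. \<forall>t\<ge>t0. g t \<le> 0"
    if lip: "\<exists>L. L-lipschitz_on {0..} g" and r: "0 \<le> k" "0 < r"
      and zero: "\<And>t. 0 \<le> t \<Longrightarrow> k = 0 \<Longrightarrow> g t \<le> 0"
      and D: "\<And>t. 0 < t \<Longrightarrow> t \<notin> N \<Longrightarrow> 0 < g t \<Longrightarrow> \<exists>D\<le>- (k * r). (g has_real_derivative D) (at t)"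
    for g k r
  proof (cases "k = 0")
    case True
    then show ?thesis using zero by (intro exI[of _ 0]) auto
  next
    case False
    then have "0 < k * r" using r by simp
    then show ?thesis using lip lipschitz_eventually_nonpos[OF _ N _ D] by blast
  qed
  have pos: "0 < 1 / m $ 1 - \<alpha>1" "0 < 1 / m $ 4 - 1 / m $ 3" "0 < 1 / m $ 2 - 1 / m $ 1" "0 < 1 / m $ 3"
    using mpos load fast by (simp_all add: field_simps)
  have uminus: "\<exists>D'\<le>- K. ((\<lambda>t. - g t) has_real_derivative D') (at t)"
    if "\<exists>D\<ge>K. (g has_real_derivative D) (at t)" for g :: "real \<Rightarrow> real" and K t
    using that DERIV_minus[of g _ t UNIV] by (metis neg_le_iff_le)
  have "\<exists>t0\<ge>0. \<forall>t\<ge>t0. x t \<le> 0"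
  proof (rule ends[OF _ nn(2) pos(1)])
    show "\<exists>L. L-lipschitz_on {0..} (x)" using lipx by simp
    show "x t \<le> 0" if "0 \<le> t" "b = 0" for t using that nn Znn by (simp add: x_def)
    fix t assume "0 < t" "t \<notin> N" "0 < x t"
    with rates[of t] show "\<exists>D\<le>- (b * (1 / m $ 1 - \<alpha>1)). ((x) has_real_derivative D) (at t)"
      by blast
  qed
  moreover have "\<exists>t0\<ge>0. \<forall>t\<ge>t0. - x t \<le> 0"
  proof (rule ends[OF _ nn(1) pos(2)])
    show "\<exists>L. L-lipschitz_on {0..} (\<lambda>t. - x t)" using lipx by simp
    show "- x t \<le> 0" if "0 \<le> t" "a = 0" for t using that nn Znn by (simp add: x_def)
    fix t assume "0 < t" "t \<notin> N" "0 < - x t"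
    with rates[of t] show "\<exists>D\<le>- (a * (1 / m $ 4 - 1 / m $ 3)). ((\<lambda>t. - x t) has_real_derivative D) (at t)"
      by (intro uminus) simp
  qed
  moreover have "\<exists>t0\<ge>0. \<forall>t\<ge>t0. y t \<le> 0"
  proof (rule ends[OF _ nn(4) pos(3)])
    show "\<exists>L. L-lipschitz_on {0..} (y)" using lipy by simp
    show "y t \<le> 0" if "0 \<le> t" "d = 0" for t using that nn Znn by (simp add: y_def)
    fix t assume "0 < t" "t \<notin> N" "0 < y t"
    with rates[of t] show "\<exists>D\<le>- (d * (1 / m $ 2 - 1 / m $ 1)). ((y) has_real_derivative D) (at t)"
      by blast
  qed
  moreover have "\<exists>t0\<ge>0. \<forall>t\<ge>t0. - y t \<le> 0"
  proof (rule ends[OF _ nn(3) pos(4)])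
    show "\<exists>L. L-lipschitz_on {0..} (\<lambda>t. - y t)" using lipy by simp
    show "- y t \<le> 0" if "0 \<le> t" "c = 0" for t using that nn Znn by (simp add: y_def)
    fix t assume "0 < t" "t \<notin> N" "0 < - y t"
    with rates[of t] show "\<exists>D\<le>- (c * (1 / m $ 3)). ((\<lambda>t. - y t) has_real_derivative D) (at t)"
      by (intro uminus) simp
  qed
  ultimately obtain t1 t2 t3 t4 where
    t: "0 \<le> t1" "\<And>t. t1 \<le> t \<Longrightarrow> x t \<le> 0" "0 \<le> t2" "\<And>t. t2 \<le> t \<Longrightarrow> - x t \<le> 0"
       "0 \<le> t3" "\<And>t. t3 \<le> t \<Longrightarrow> y t \<le> 0" "0 \<le> t4" "\<And>t. t4 \<le> t \<Longrightarrow> - y t \<le> 0" by blast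
  show "\<exists>t0\<ge>0. \<forall>t\<ge>t0. Z t = \<Delta> *v W t"
  proof (intro exI[of _ "t1 + t2 + t3 + t4"] conjI allI impI)
    fix s assume s: "t1 + t2 + t3 + t4 \<le> s"
    have "x s = 0" "y s = 0" using t(2)[of s] t(4)[of s] t(6)[of s] t(8)[of s] t(1,3,5,7) s by auto
    then have "\<epsilon> s = 0" using \<epsilon>[of s] s t(1,3,5,7) by (simp add: vec_eq_iff forall_4)
    then show "Z s = \<Delta> *v W s" using \<epsilon>eq[of s] s t(1,3,5,7) by simp
  qed (use t in simp)
qed

section \<open>Robust stability\<close>

theorem corollary9:
  fixes \<alpha>1 :: real and m :: "real^4"
  assumes "\<alpha>1 \<ge> 0"
    and "\<forall>k. m $ k > 0"
    and "balanced \<alpha>1 m"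
    and "m $ 1 + m $ 4 = 1" and "m $ 2 + m $ 3 = 1"
  shows "(load \<alpha>1 m $ 1 = load \<alpha>1 m $ 2 \<and> load \<alpha>1 m $ 2 < 1 \<longleftrightarrow> \<alpha>1 < 1) \<and>
         (load \<alpha>1 m $ 1 = load \<alpha>1 m $ 2 \<and> load \<alpha>1 m $ 2 < 1 \<and> m $ 2 + m $ 4 < 1
            \<longrightarrow> robustly_queue_ratio_stable \<alpha>1 m)"
proof (intro conjI impI)
  \<comment> \<open>Each station's service times add up to 1.\<close>
  have load: "load \<alpha>1 m $ j = \<alpha>1" for j
    using load_components[of \<alpha>1 m] assms(4,5) exhaust_2[of j] by auto
  show "load \<alpha>1 m $ 1 = load \<alpha>1 m $ 2 \<and> load \<alpha>1 m $ 2 < 1 \<longleftrightarrow> \<alpha>1 < 1"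
    by (simp add: load)
  assume "load \<alpha>1 m $ 1 = load \<alpha>1 m $ 2 \<and> load \<alpha>1 m $ 2 < 1 \<and> m $ 2 + m $ 4 < 1"
  \<comment> \<open>Replacing \<open>m $ 4\<close> by \<open>1 - m $ 1\<close>, or
    \<open>m $ 2\<close> by \<open>1 - m $ 3\<close>, gives the two inequalities.\<close>
  then have \<alpha>: "\<alpha>1 < 1" and fast: "m $ 2 < m $ 1" "m $ 4 < m $ 3" using assms(4,5) by (auto simp: load)
  have mpos: "0 < m $ k" for k using assms(2) by simp
  show "robustly_queue_ratio_stable \<alpha>1 m"
    unfolding robustly_queue_ratio_stable_def
  proof (intro allI impI conjI)
    fix \<Delta> assume ratio: "ratio_matrix m \<Delta>"
    have "\<alpha>1 * m $ 1 \<le> \<alpha>1 * 1" using assms(1,4) mpos[of 4] by (intro mult_left_mono) auto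
    then show "SSC \<alpha>1 m \<Delta>"
      using SSC_of_fast_feedback[OF assms(2,1) _ fast ratio] \<alpha> by simp
    define G where "G = Cmat ** Mmat m ** Qmat ** \<Delta>"
    define a b c d where "a = \<Delta> $ 1 $ 1" and "b = \<Delta> $ 4 $ 1" and "c = \<Delta> $ 2 $ 2" and "d = \<Delta> $ 3 $ 2"
    have nn: "0 \<le> a" "0 \<le> b" "0 \<le> c" "0 \<le> d" and ab: "m $ 1 * a + m $ 4 * b = 1" and cd: "m $ 2 * c + m $ 3 * d = 1"
      using ratio_matrix_components(5-7)[OF ratio] by (auto simp: a_def b_def c_def d_def)
    have G: "G $ 1 $ 1 = a + m $ 4 * b" "G $ 1 $ 2 = m $ 4 * (c + d)" "G $ 2 $ 1 = a" "G $ 2 $ 2 = c + m $ 3 * d"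
      using workload_matrix_components[OF ratio] assms(4,5) by (simp_all add: G_def a_def b_def c_def d_def)
    have ab0: "0 < a \<or> 0 < b" and cd0: "0 < c \<or> 0 < d" using nn ab cd by (auto simp: less_le)
    have mb: "0 \<le> m $ 4 * b" using mpos[of 4] nn by simp
    have G11: "0 < G $ 1 $ 1"
      unfolding G using ab0 nn mb mpos[of 4] by (auto intro: add_pos_nonneg add_nonneg_pos)
    have G12: "0 < G $ 1 $ 2"
      unfolding G using cd0 nn mpos[of 4] by (auto intro: add_pos_nonneg add_nonneg_pos)
    have m41: "m $ 4 < 1" using assms(4) mpos[of 1] by simp
    \<comment> \<open>Termwise comparison of \<open>m $ 4 * (c + d)\<close> with
      \<open>c + m $ 3 * d\<close>; it is strict because \<open>c\<close> or \<open>d\<close> is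
      positive.\<close>
    have "m $ 4 * c \<le> c" "m $ 4 * d \<le> m $ 3 * d" using nn m41 fast by (auto intro: mult_left_le_one_le mult_right_mono simp: less_imp_le mpos)
    moreover have "m $ 4 * c < c \<or> m $ 4 * d < m $ 3 * d" using cd0 m41 fast by auto
    ultimately have G22: "G $ 1 $ 2 < G $ 2 $ 2" unfolding G by (auto simp: algebra_simps)
    have "G $ 1 $ 2 * G $ 2 $ 1 < G $ 2 $ 2 * G $ 1 $ 1"
    proof -
      have "G $ 1 $ 2 * G $ 2 $ 1 \<le> G $ 1 $ 2 * G $ 1 $ 1" using G12 mb by (intro mult_left_mono) (auto simp: G(1,3))
      also have "\<dots> < G $ 2 $ 2 * G $ 1 $ 1" using G22 G11 by (rule mult_strict_right_mono)
      finally show ?thesis .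
    qed
    then have "det G \<noteq> 0" by (simp add: det_2 mult.commute)
    then have inv: "invertible G" by (simp add: invertible_det_nz)
    then show "invertible (Cmat ** Mmat m ** Qmat ** \<Delta>)" by (simp add: G_def)
    have GR: "G ** Rmat m \<Delta> = mat 1"
      unfolding Rmat_def G_def[symmetric] using inv matrix_inv_eqI by (auto simp: invertible_def)
    show "SP_stable (Rmat m \<Delta>) (drift \<alpha>1 m \<Delta>)"
    proof (rule SP_stable_of_inverse[OF GR, of _ "1 - \<alpha>1"])
      \<comment> \<open>\<open>G\<close> undoes the matrix in the drift and leaves the load minus
        the all-ones vector.\<close>
      show "(G *v drift \<alpha>1 m \<Delta>) $ j = - (1 - \<alpha>1)" for j
        unfolding drift_def by (simp add: matrix_vector_mul_assoc GR load)
    qed (use \<alpha> G11 G12 G22 nn mb in \<open>simp_all add: G\<close>)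
  qed
qed

end
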